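(* Let $r>1/2$ and fix $\beta_0,\beta_1>0$ with $\beta_0+\beta_1\zeta(2r)=1$ (so that the initial error of $\mathcal{H}^{\mathrm{Kor}}_r(\mathbb{T}^d)\hookrightarrow L_\infty(\mathbb{T}^d)$ equals $1$ for all $d$). Then uniform approximation on the unweighted Korobov spaces is polynomially tractable for Monte Carlo methods using linear information: there is a constant $C>0$, which may depend on $r$ but not on $d$ or $\varepsilon$, such that for all $d\in\mathbb{N}$ and $\varepsilon>0$, \[ n^{\mathrm{ran}}\bigl(\varepsilon,\mathcal{H}^{\mathrm{Kor}}_r(\mathbb{T}^d)\hookrightarrow L_\infty(\mathbb{T}^d)\bigr)\le C\,\varepsilon^{-2}\,d\,(1+\log d). \]
   Context: $\mathbb{T}=[0,1)$ is the one-dimensional torus, $\mathbb{T}^d$ the $d$-torus. The Korobov space $\mathcal{H}^{\mathrm{Kor}}_r(\mathbb{T})$ is the real Hilbert space of functions on $\mathbb{T}$ with orthonormal basis $\psi_0:=\sqrt{\beta_0}$, $\psi_{-k}:=\sqrt{\beta_1}k^{-r}\sin(2\pi k\,\cdot)$, $\psi_k:=\sqrt{\beta_1}k^{-r}\cos(2\pi k\,\cdot)$, $k\in\mathbb{N}$; $\mathcal{H}^{\mathrm{Kor}}_r(\mathbb{T}^d)$ is the unweighted tensor product space with orthonormal basis $\psi_{\mathbf{k}}(\mathbf{x})=\prod_{j=1}^d\psi_{k_j}(x_j)$, $\mathbf{k}\in\mathbb{Z}^d$. $\zeta$ is the Riemann zeta function. Randomized setting with linear information: a randomized method is a family $(A_n^{\omega})_{\omega}$,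 indexed by an element of a probability space, of maps $A_n^{\omega}=\phi^{\omega}\circ N^{\omega}$ with $N^{\omega}(f)=(L^{\omega}_1(f),\ldots,L^{\omega}_n(f))$ for continuous linear functionals $L_i^{\omega}$ and $\phi^\omega:\mathbb{R}^n\to L_\infty(\mathbb{T}^d)$; its error is $\sup_{\|f\|\le1}\mathbb{E}\|f-A_n^{\omega}(f)\|_{L_\infty}$; $n^{\mathrm{ran}}(\varepsilon,\cdot)$ is the minimal $n\in\mathbb{N}_0$ such that some randomized method using $n$ pieces of information has error at most $\varepsilon$. *)

theory Defs
  imports "HOL-Probability.Probability"
begin

definition zeta_real :: "real \<Rightarrow> real" where
  "zeta_real s = (\<Sum>k. 1 / real (Suc k) powr s)"

definition Zd :: "nat \<Rightarrow> (nat \<Rightarrow> int) set" where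
  "Zd d = {k. \<forall>j. d \<le> j \<longrightarrow> k j = 0}"

text \<open>Univariate orthonormal basis psi_m, m in Z (psi_{-k} = sine, psi_k = cosine).\<close>
definition psi1 :: "real \<Rightarrow> real \<Rightarrow> real \<Rightarrow> int \<Rightarrow> real \<Rightarrow> real" where
  "psi1 \<beta>0 \<beta>1 r m x =
     (if m = 0 then sqrt \<beta>0
      else if m < 0 then sqrt \<beta>1 * real_of_int (- m) powr (- r) * sin (2 * pi * real_of_int (- m) * x)
      else sqrt \<beta>1 * real_of_int m powr (- r) * cos (2 * pi * real_of_int m * x))"

definition psi :: "real \<Rightarrow> real \<Rightarrow> real \<Rightarrow> nat \<Rightarrow> (nat \<Rightarrow> int) \<Rightarrow> (nat \<Rightarrow> real) \<Rightarrow> real" where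
  "psi \<beta>0 \<beta>1 r d k x = (\<Prod>j<d. psi1 \<beta>0 \<beta>1 r (k j) (x j))"

text \<open>The Korobov space, represented via coefficient families w.r.t. the ONB (l^2(Z^d)).\<close>
definition kor_space :: "nat \<Rightarrow> ((nat \<Rightarrow> int) \<Rightarrow> real) set" where
  "kor_space d = {c. (\<forall>k. k \<notin> Zd d \<longrightarrow> c k = 0) \<and> (\<lambda>k. (c k)\<^sup>2) summable_on Zd d}"

definition kor_norm :: "nat \<Rightarrow> ((nat \<Rightarrow> int) \<Rightarrow> real) \<Rightarrow> real" where
  "kor_norm d c = sqrt (\<Sum>\<^sub>\<infinity>k\<in>Zd d. (c k)\<^sup>2)"

definition kor_fun :: "real \<Rightarrow> real \<Rightarrow> real \<Rightarrow> nat \<Rightarrow> ((nat \<Rightarrow> int) \<Rightarrow> real) \<Rightarrow> (nat \<Rightarrow> real) \<Rightarrow> real" where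
  "kor_fun \<beta>0 \<beta>1 r d c = (\<lambda>x. \<Sum>\<^sub>\<infinity>k\<in>Zd d. c k * psi \<beta>0 \<beta>1 r d k x)"

definition torus_measure :: "nat \<Rightarrow> (nat \<Rightarrow> real) measure" where
  "torus_measure d = (\<Pi>\<^sub>M j\<in>{..<d}. restrict_space lborel {0..<1::real})"

definition linf_dist :: "nat \<Rightarrow> ((nat \<Rightarrow> real) \<Rightarrow> real) \<Rightarrow> ((nat \<Rightarrow> real) \<Rightarrow> real) \<Rightarrow> ereal" where
  "linf_dist d f g = esssup (torus_measure d) (\<lambda>x. ereal \<bar>f x - g x\<bar>)"

definition cont_lin_functional :: "nat \<Rightarrow> (((nat \<Rightarrow> int) \<Rightarrow> real) \<Rightarrow> real) \<Rightarrow> bool" where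
  "cont_lin_functional d L \<longleftrightarrow>
     (\<forall>c\<in>kor_space d. \<forall>c'\<in>kor_space d. L (\<lambda>k. c k + c' k) = L c + L c') \<and>
     (\<forall>a. \<forall>c\<in>kor_space d. L (\<lambda>k. a * c k) = a * L c) \<and>
     (\<exists>B. \<forall>c\<in>kor_space d. \<bar>L c\<bar> \<le> B * kor_norm d c)"

definition ran_output :: "nat \<Rightarrow> ('w \<Rightarrow> nat \<Rightarrow> (((nat \<Rightarrow> int) \<Rightarrow> real) \<Rightarrow> real))
     \<Rightarrow> ('w \<Rightarrow> (nat \<Rightarrow> real) \<Rightarrow> ((nat \<Rightarrow> real) \<Rightarrow> real)) \<Rightarrow> 'w \<Rightarrow> ((nat \<Rightarrow> int) \<Rightarrow> real) \<Rightarrow> ((nat \<Rightarrow> real) \<Rightarrow> real)" where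
  "ran_output n L \<phi> \<omega> c = \<phi> \<omega> (\<lambda>i. if i < n then L \<omega> i c else 0)"

text \<open>Admissible randomized method using n pieces of linear information,
  on the probability space P: continuous linear functionals, outputs in L_infinity,
  and measurable error in omega (so that the expectation is defined).\<close>
definition ran_method :: "real \<Rightarrow> real \<Rightarrow> real \<Rightarrow> nat \<Rightarrow> nat \<Rightarrow> 'w measure
     \<Rightarrow> ('w \<Rightarrow> nat \<Rightarrow> (((nat \<Rightarrow> int) \<Rightarrow> real) \<Rightarrow> real))
     \<Rightarrow> ('w \<Rightarrow> (nat \<Rightarrow> real) \<Rightarrow> ((nat \<Rightarrow> real) \<Rightarrow> real)) \<Rightarrow> bool" where
  "ran_method \<beta>0 \<beta>1 r d n P L \<phi> \<longleftrightarrow>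
     prob_space P \<and>
     (\<forall>\<omega>\<in>space P. (\<forall>i<n. cont_lin_functional d (L \<omega> i)) \<and>
        (\<forall>y. \<phi> \<omega> y \<in> borel_measurable (torus_measure d) \<and>
             esssup (torus_measure d) (\<lambda>x. ereal \<bar>\<phi> \<omega> y x\<bar>) < \<infinity>)) \<and>
     (\<forall>c\<in>kor_space d.
        (\<lambda>\<omega>. linf_dist d (kor_fun \<beta>0 \<beta>1 r d c) (ran_output n L \<phi> \<omega> c)) \<in> borel_measurable P)"

definition ran_error :: "real \<Rightarrow> real \<Rightarrow> real \<Rightarrow> nat \<Rightarrow> nat \<Rightarrow> 'w measure
     \<Rightarrow> ('w \<Rightarrow> nat \<Rightarrow> (((nat \<Rightarrow> int) \<Rightarrow> real) \<Rightarrow> real))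
     \<Rightarrow> ('w \<Rightarrow> (nat \<Rightarrow> real) \<Rightarrow> ((nat \<Rightarrow> real) \<Rightarrow> real)) \<Rightarrow> ennreal" where
  "ran_error \<beta>0 \<beta>1 r d n P L \<phi> =
     (SUP c\<in>{c\<in>kor_space d. kor_norm d c \<le> 1}.
        \<integral>\<^sup>+ \<omega>. e2ennreal (linf_dist d (kor_fun \<beta>0 \<beta>1 r d c) (ran_output n L \<phi> \<omega> c)) \<partial>P)"

definition n_ran :: "real \<Rightarrow> real \<Rightarrow> real \<Rightarrow> nat \<Rightarrow> real \<Rightarrow> nat" where
  "n_ran \<beta>0 \<beta>1 r d \<epsilon> =
     (LEAST n. \<exists>(P :: (nat \<Rightarrow> real) measure) L \<phi>.
        ran_method \<beta>0 \<beta>1 r d n P L \<phi> \<and> ran_error \<beta>0 \<beta>1 r d n P L \<phi> \<le> ennreal \<epsilon>)"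

end

theory Submission
  imports Defs
begin

text \<open>
  For random sign vectors \<open>\<xi>\<^sub>1, \<dots>, \<xi>\<^sub>n\<close> on a large finite set \<open>A\<close> of frequencies, the average of the rank-one
  operators \<open>f \<mapsto> \<langle>\<xi>\<^sub>i, f\<rangle> \<Sum>\<^sub>k \<xi>\<^sub>i(k) \<psi>\<^sub>k\<close> is an unbiased estimator of the truncation of \<open>f\<close> to \<open>A\<close> from
  \<open>n\<close> functionals. Its error at a point is a centred average of products \<open>\<langle>\<xi>\<^sub>i, c\<rangle> \<langle>\<xi>\<^sub>i, h\<rangle>\<close>, which obeys a
  Bernstein-type exponential bound in \<open>\<parallel>h\<parallel>\<close>. The points of the torus embed into the Hilbert space
  with squared distances \<open>2(1 - K(x,y)) \<le> C d \<bar>x - y\<bar>\<^sup>s\<close> for some \<open>s > 0\<close>, so dyadic grids with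
  \<open>2\<^sup>l \<approx> d\<^sup>1\<^sup>/\<^sup>s\<close> and finer, having \<open>2\<^sup>d\<^sup>l\<close> points, give by chaining an expected uniform error of order
  \<open>(d (1 + log d) / n)\<^sup>1\<^sup>/\<^sup>2\<close>. The output is a step function on a very fine grid, so that only finitely many
  points matter and \<open>A\<close> can be chosen finite.
\<close>

subsection \<open>Products of sums over the integers\<close>

lemma Zd_Suc_eq: "Zd (Suc d) = (\<lambda>(k, m). k(d := m)) ` (Zd d \<times> UNIV)"
proof (intro equalityI subsetI)
  fix k assume "k \<in> Zd (Suc d)"
  then have "(k(d := 0), k d) \<in> Zd d \<times> UNIV" "k = (\<lambda>(k, m). k(d := m)) (k(d := 0), k d)"
    by (auto simp: Zd_def)
  then show "k \<in> (\<lambda>(k, m). k(d := m)) ` (Zd d \<times> UNIV)"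
    by blast
qed (auto simp: Zd_def)

lemma inj_on_Zd_update: "inj_on (\<lambda>(k, m). k(d := m)) (Zd d \<times> UNIV)"
proof (rule inj_onI, clarsimp)
  fix k m k' m' assume *: "k \<in> Zd d" "k' \<in> Zd d" "k(d := m) = k'(d := m')"
  have "k j = k' j" for j
    using fun_cong[OF *(3), of j] *(1,2) by (cases "j = d") (auto simp: Zd_def)
  then show "k = k' \<and> m = m'"
    using fun_cong[OF *(3), of d] by auto
qed

text \<open>Induction on \<open>d\<close>: \<open>Zd (Suc d)\<close> is reindexed by
  \<open>Zd d\<close> times the integers, and absolute convergence allows the double sum to be
  evaluated one coordinate at a time. Absolute summability is carried along because the next product
  step consumes it.\<close>

lemma Zd_has_sum_prod:
  fixes g :: "nat \<Rightarrow> int \<Rightarrow> real"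
  assumes "\<And>j. j < d \<Longrightarrow> (\<lambda>m. \<bar>g j m\<bar>) summable_on UNIV"
    and "\<And>j. j < d \<Longrightarrow> (g j has_sum s j) UNIV"
  shows "(\<lambda>k. \<bar>\<Prod>j<d. g j (k j)\<bar>) summable_on Zd d"
    and "((\<lambda>k. \<Prod>j<d. g j (k j)) has_sum (\<Prod>j<d. s j)) (Zd d)"
proof -
  have "(\<lambda>k. \<bar>\<Prod>j<d. g j (k j)\<bar>) summable_on Zd d \<and>
      ((\<lambda>k. \<Prod>j<d. g j (k j)) has_sum (\<Prod>j<d. s j)) (Zd d)"
  using assms
  proof (induction d)
    case 0
    have "Zd 0 = {\<lambda>_. 0}" by (auto simp: Zd_def)
    moreover have "((\<lambda>k::nat \<Rightarrow> int. 1::real) has_sum 1) {\<lambda>_. 0}"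
      using has_sum_finite[of "{\<lambda>_. 0}" "\<lambda>k. 1::real"] by simp
    ultimately show ?case
      by (auto intro: has_sum_imp_summable)
  next
    case (Suc d)
    let ?G = "\<lambda>k. \<Prod>j<d. g j (k j)"
    have G: "(\<lambda>k. \<bar>?G k\<bar>) summable_on Zd d" "(?G has_sum (\<Prod>j<d. s j)) (Zd d)"
      using Suc.IH Suc.prems by auto
    have comp: "(\<lambda>k. \<Prod>j<Suc d. g j (k j)) \<circ> (\<lambda>(k, m). k(d := m)) = (\<lambda>(k, m). ?G k * g d m)"
      by (auto simp: fun_eq_iff intro!: prod.cong)
    have comp': "(\<lambda>k. \<bar>\<Prod>j<Suc d. g j (k j)\<bar>) \<circ> (\<lambda>(k, m). k(d := m)) = (\<lambda>(k, m). \<bar>?G k * g d m\<bar>)"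
      using fun_cong[OF comp] by (auto simp: fun_eq_iff)
    have abs: "(\<lambda>(k, m). \<bar>?G k * g d m\<bar>) summable_on (Zd d \<times> UNIV)"
    proof -
      have "(\<lambda>p. norm (case p of (k, m) \<Rightarrow> ?G k * g d m)) summable_on (Zd d \<times> UNIV)"
        unfolding Infinite_Sum.abs_summable_on_Sigma_iff using G(1) Suc.prems(1)[of d]
        by (auto simp: abs_mult infsum_cmult_right' intro!: summable_on_cmult_right summable_on_cmult_left)
      then show ?thesis by (simp add: case_prod_unfold)
    qed
    then have "(\<lambda>k. \<bar>\<Prod>j<Suc d. g j (k j)\<bar>) summable_on Zd (Suc d)"
      unfolding Zd_Suc_eq summable_on_reindex[OF inj_on_Zd_update] comp' .
    moreover have "((\<lambda>(k, m). ?G k * g d m) has_sum ((\<Prod>j<d. s j) * s d)) (Zd d \<times> UNIV)"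
    proof (rule has_sum_SigmaI)
      show "(\<lambda>(k, m). ?G k * g d m) summable_on (Zd d \<times> UNIV)"
        by (rule abs_summable_summable) (use abs in \<open>simp add: case_prod_unfold\<close>)
      show "((\<lambda>k. ?G k * s d) has_sum (\<Prod>j<d. s j) * s d) (Zd d)"
        by (rule has_sum_cmult_left[OF G(2)])
    next
      fix k show "((\<lambda>y. case (k, y) of (k, m) \<Rightarrow> ?G k * g d m) has_sum ?G k * s d) UNIV"
        using has_sum_cmult_right[OF Suc.prems(2)[of d], of "?G k"] by simp
    qed
    then have "((\<lambda>k. \<Prod>j<Suc d. g j (k j)) has_sum (\<Prod>j<Suc d. s j)) (Zd (Suc d))"
      unfolding Zd_Suc_eq has_sum_reindex[OF inj_on_Zd_update] comp by simp
    ultimately show ?case ..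
  qed
  then show "(\<lambda>k. \<bar>\<Prod>j<d. g j (k j)\<bar>) summable_on Zd d"
    and "((\<lambda>k. \<Prod>j<d. g j (k j)) has_sum (\<Prod>j<d. s j)) (Zd d)"
    by blast+
qed

text \<open>Links unordered sums over the integers to ordinary series. The frequencies
  \<open>k\<close> and \<open>- k\<close> share one index so that cosine and sine terms can be
  combined later.\<close>

lemma int_has_sum_split:
  fixes g :: "int \<Rightarrow> real"
  assumes "summable (\<lambda>k. \<bar>g (int (Suc k))\<bar>)" and "summable (\<lambda>k. \<bar>g (- int (Suc k))\<bar>)"
  shows "(\<lambda>m. \<bar>g m\<bar>) summable_on UNIV"
    and "(g has_sum (g 0 + (\<Sum>k. g (int (Suc k)) + g (- int (Suc k))))) UNIV"
proof -
  have U: "(UNIV :: int set) = {0} \<union> (range (\<lambda>k. int (Suc k)) \<union> range (\<lambda>k. - int (Suc k)))"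
  proof -
    have "m \<in> {0} \<union> (range (\<lambda>k. int (Suc k)) \<union> range (\<lambda>k. - int (Suc k)))" for m :: int
    proof (cases m rule: int_cases3)
      case (pos n) then show ?thesis by (auto intro: image_eqI[of _ _ "n - 1"])
    next
      case (neg n) then show ?thesis by (auto intro: image_eqI[of _ _ "n - 1"])
    qed auto
    then show ?thesis by blast
  qed
  have inj: "inj (\<lambda>k. int (Suc k))" "inj (\<lambda>k. - int (Suc k))"
    by (auto simp: inj_def)
  \<comment> \<open>Stated for every \<open>h\<close> with the absolute values of \<open>g\<close>:
    the choice \<open>g\<close> gives the sum, the choice of the absolute value of \<open>g\<close>
    gives absolute summability.\<close>
  have main: "(h has_sum (h 0 + (\<Sum>k. h (int (Suc k)) + h (- int (Suc k))))) UNIV"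
    if h: "\<And>m. \<bar>h m\<bar> = \<bar>g m\<bar>" for h :: "int \<Rightarrow> real"
  proof -
    have s: "summable (\<lambda>k. h (int (Suc k)))" "summable (\<lambda>k. h (- int (Suc k)))"
      by (rule summable_rabs_cancel; use assms h in simp)+
    have p: "(h has_sum (\<Sum>k. h (int (Suc k)))) (range (\<lambda>k. int (Suc k)))"
      unfolding has_sum_reindex[OF inj(1)] o_def
      by (rule norm_summable_imp_has_sum) (use assms h s in \<open>auto intro: summable_sums\<close>)
    have n: "(h has_sum (\<Sum>k. h (- int (Suc k)))) (range (\<lambda>k. - int (Suc k)))"
      unfolding has_sum_reindex[OF inj(2)] o_def
      by (rule norm_summable_imp_has_sum) (use assms h s in \<open>auto intro: summable_sums\<close>)
    have z: "(h has_sum h 0) {0}"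
      using has_sum_finite[of "{0}" h] by simp
    have "(h has_sum (h 0 + ((\<Sum>k. h (int (Suc k))) + (\<Sum>k. h (- int (Suc k)))))) UNIV"
      unfolding U by (intro has_sum_Un_disjoint z p n) auto
    then show ?thesis unfolding suminf_add[OF s] .
  qed
  show "(g has_sum (g 0 + (\<Sum>k. g (int (Suc k)) + g (- int (Suc k))))) UNIV"
    by (rule main) simp
  show "(\<lambda>m. \<bar>g m\<bar>) summable_on UNIV"
    by (rule has_sum_imp_summable, rule main) simp
qed

subsection \<open>The reproducing kernel\<close>

text \<open>Interpolates between the quadratic bound near 0 and the trivial bound 2. A small
  \<open>s\<close> is what a series with coefficients of order \<open>k powr (- (2 * r))\<close> can
  still absorb when \<open>r\<close> is close to 1/2.\<close>

lemma one_minus_cos_le: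
  fixes \<theta> s :: real
  assumes "0 < s" "s \<le> 2"
  shows "1 - cos \<theta> \<le> 2 * \<bar>\<theta>\<bar> powr s"
proof (cases "\<bar>\<theta>\<bar> \<le> 1")
  case True
  have "1 - cos \<theta> = 2 * (sin (\<theta> / 2))\<^sup>2"
    using cos_double_sin[of "\<theta> / 2"] by simp
  also have "(sin (\<theta> / 2))\<^sup>2 \<le> (\<theta> / 2)\<^sup>2"
    using abs_sin_x_le_abs_x[of "\<theta> / 2"] by (metis abs_le_square_iff)
  also have "(\<theta> / 2)\<^sup>2 \<le> \<bar>\<theta>\<bar> powr s"
  proof (cases "\<theta> = 0")
    case False
    have "(\<theta> / 2)\<^sup>2 \<le> \<bar>\<theta>\<bar>\<^sup>2" by (simp add: power_divide)
    also have "\<dots> = \<bar>\<theta>\<bar> powr 2" using False by (simp add: powr_numeral)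
    also have "\<dots> \<le> \<bar>\<theta>\<bar> powr s" using assms True False by (intro powr_mono') auto
    finally show ?thesis .
  qed auto
  finally show ?thesis by simp
next
  case False
  then have "1 \<le> \<bar>\<theta>\<bar> powr s" using assms by (intro ge_one_powr_ge_zero) auto
  then show ?thesis using cos_ge_minus_one[of \<theta>] by linarith
qed

text \<open>With \<open>P\<close> the product of the earlier factors,
  \<open>1 - P * a = a * (1 - P) + (1 - a)\<close>, where \<open>1 - P\<close> is nonnegative. This
  is what makes squared distances grow only linearly in the dimension.\<close>

lemma one_minus_prod_le:
  fixes a :: "nat \<Rightarrow> real"
  assumes "\<And>j. j < d \<Longrightarrow> \<bar>a j\<bar> \<le> 1"
  shows "1 - (\<Prod>j<d. a j) \<le> (\<Sum>j<d. 1 - a j)"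
  using assms
proof (induction d)
  case (Suc d)
  have P: "\<bar>\<Prod>j<d. a j\<bar> \<le> 1"
    unfolding abs_prod by (intro prod_le_1) (use Suc.prems in auto)
  have "a d * (1 - (\<Prod>j<d. a j)) \<le> 1 * (1 - (\<Prod>j<d. a j))"
    using P Suc.prems[of d] by (intro mult_right_mono) auto
  then show ?case using Suc by (simp add: algebra_simps)
qed simp

section \<open>Univariate kernel: normalisation and Hoelder continuity\<close>

locale korobov =
  fixes r \<beta>0 \<beta>1 :: real
  assumes r: "r > 1/2" and \<beta>0: "\<beta>0 > 0" and \<beta>1: "\<beta>1 > 0"
    and norm1: "\<beta>0 + \<beta>1 * zeta_real (2 * r) = 1"
begin

definition w :: "nat \<Rightarrow> real" where
  "w k = \<beta>1 * real (Suc k) powr (- (2 * r))"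

text \<open>The univariate reproducing kernel as a function of the difference of its arguments;
  \<open>psi1_has_sum\<close> justifies this reading.\<close>

definition \<kappa> :: "real \<Rightarrow> real" where
  "\<kappa> t = \<beta>0 + (\<Sum>k. w k * cos (2 * pi * real (Suc k) * t))"

text \<open>Hoelder exponent of the kernel. Half of \<open>2 * r - 1\<close> keeps
  \<open>2 * r - s\<close> above 1 for every \<open>r > 1/2\<close>, and the cap 1 stays within the
  range of \<open>one_minus_cos_le\<close>.\<close>

definition s :: real where
  "s = min 1 ((2 * r - 1) / 2)"

lemma s_bounds: "0 < s" "s \<le> 1" "1 < 2 * r - s"
  using r by (auto simp: s_def min_def field_simps)

lemma w_nonneg: "0 \<le> w k"
  using \<beta>1 by (simp add: w_def)

lemma summable_Suc_powr: "a > 1 \<Longrightarrow> summable (\<lambda>k. real (Suc k) powr (- a))"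
  using summable_Suc_iff[of "\<lambda>k. real k powr (- a)"] by (simp add: summable_real_powr_iff)

text \<open>The normalisation in series form. It makes the kernel equal to 1 on the diagonal, so
  points of the torus become unit vectors in every dimension.\<close>

lemma w_sums: "w sums (1 - \<beta>0)"
proof -
  have "w k = \<beta>1 * (1 / real (Suc k) powr (2 * r))" for k
    by (simp add: w_def powr_minus_divide)
  then have w_eq: "w = (\<lambda>k. \<beta>1 * (1 / real (Suc k) powr (2 * r)))"
    by blast
  have "summable (\<lambda>k. 1 / real (Suc k) powr (2 * r))"
    using summable_Suc_powr[of "2 * r"] r by (simp add: powr_minus_divide)
  then have "w sums (\<beta>1 * zeta_real (2 * r))"
    unfolding zeta_real_def w_eq by (intro sums_mult summable_sums)
  moreover have "\<beta>1 * zeta_real (2 * r) = 1 - \<beta>0" using norm1 by linarith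
  ultimately show ?thesis by metis
qed

lemma summable_w: "summable w"
  using w_sums by (simp add: sums_iff)

lemma summable_w_bounded:
  assumes "\<And>k. \<bar>b k\<bar> \<le> 1"
  shows "summable (\<lambda>k. \<bar>w k * b k\<bar>)"
  by (rule summable_comparison_test'[OF summable_w, of 0])
    (use assms w_nonneg in \<open>auto simp: abs_mult mult_left_le\<close>)

lemma kappa_0: "\<kappa> 0 = 1"
  using w_sums by (simp add: \<kappa>_def sums_iff)

lemma one_minus_kappa:
  "(\<lambda>k. w k * (1 - cos (2 * pi * real (Suc k) * t))) sums (1 - \<kappa> t)"
proof -
  have "summable (\<lambda>k. w k * cos (2 * pi * real (Suc k) * t))"
    by (rule summable_rabs_cancel, rule summable_w_bounded) simp
  from sums_diff[OF w_sums summable_sums[OF this]] show ?thesis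
    unfolding \<kappa>_def right_diff_distrib mult_1_right diff_diff_eq .
qed

lemma abs_kappa_le: "\<bar>\<kappa> t\<bar> \<le> 1"
proof -
  have "\<bar>\<Sum>k. w k * cos (2 * pi * real (Suc k) * t)\<bar> \<le> (\<Sum>k. \<bar>w k * cos (2 * pi * real (Suc k) * t)\<bar>)"
    by (rule summable_rabs, rule summable_w_bounded) simp
  also have "\<dots> \<le> (\<Sum>k. w k)"
    by (rule suminf_le[OF _ summable_w_bounded summable_w])
      (use w_nonneg in \<open>auto simp: abs_mult mult_left_le\<close>)
  also have "\<dots> = 1 - \<beta>0" using w_sums by (simp add: sums_iff)
  finally show ?thesis using \<beta>0 by (auto simp: \<kappa>_def)
qed

definition hoelder_const :: real where
  "hoelder_const = (\<Sum>k. 2 * (2 * pi) powr s * \<beta>1 * real (Suc k) powr (- (2 * r - s)))"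

lemma hoelder_const_nonneg: "0 \<le> hoelder_const"
  unfolding hoelder_const_def using \<beta>1 s_bounds summable_Suc_powr[of "2 * r - s"]
  by (intro suminf_nonneg summable_mult) auto

text \<open>Termwise use of \<open>one_minus_cos_le\<close>: the resulting factor
  \<open>real (Suc k) powr s\<close> uses up part of the decay of \<open>w k\<close>, and the
  remaining exponent still exceeds 1.\<close>

lemma one_minus_kappa_le: "1 - \<kappa> t \<le> hoelder_const * \<bar>t\<bar> powr s"
proof -
  let ?c = "2 * (2 * pi) powr s * \<beta>1"
  have S: "summable (\<lambda>k. real (Suc k) powr (- (2 * r - s)))"
    using s_bounds summable_Suc_powr[of "2 * r - s"] by auto
  have "w k * (1 - cos (2 * pi * real (Suc k) * t)) \<le> ?c * real (Suc k) powr (- (2 * r - s)) * \<bar>t\<bar> powr s" for k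
  proof -
    have "1 - cos (2 * pi * real (Suc k) * t) \<le> 2 * \<bar>2 * pi * real (Suc k) * t\<bar> powr s"
      using s_bounds by (intro one_minus_cos_le) auto
    also have "\<dots> = 2 * (2 * pi) powr s * real (Suc k) powr s * \<bar>t\<bar> powr s"
      unfolding abs_mult by (subst powr_mult | simp)+
    finally have "w k * (1 - cos (2 * pi * real (Suc k) * t))
        \<le> w k * (2 * (2 * pi) powr s * real (Suc k) powr s * \<bar>t\<bar> powr s)"
      by (rule mult_left_mono[OF _ w_nonneg])
    also have "\<dots> = ?c * (real (Suc k) powr (-(2 * r)) * real (Suc k) powr s) * \<bar>t\<bar> powr s"
      unfolding w_def by (simp only: mult.assoc mult.left_commute mult.commute)
    also have "real (Suc k) powr (-(2 * r)) * real (Suc k) powr s = real (Suc k) powr (- (2 * r - s))"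
      unfolding powr_add[symmetric] by (rule arg_cong[where f = "\<lambda>a. real (Suc k) powr a"]) simp
    finally show ?thesis .
  qed
  moreover have "(\<lambda>k. ?c * real (Suc k) powr (- (2 * r - s)) * \<bar>t\<bar> powr s) sums (hoelder_const * \<bar>t\<bar> powr s)"
    unfolding hoelder_const_def by (intro sums_mult2 summable_sums summable_mult S)
  ultimately show ?thesis
    by (rule sums_le[OF _ one_minus_kappa])
qed

text \<open>The frequencies \<open>k\<close> and \<open>- k\<close> together contribute cos cos +
  sin sin, the cosine of the difference of the arguments.\<close>

lemma psi1_has_sum:
  shows "(\<lambda>m. \<bar>psi1 \<beta>0 \<beta>1 r m x * psi1 \<beta>0 \<beta>1 r m y\<bar>) summable_on UNIV"
    and "((\<lambda>m. psi1 \<beta>0 \<beta>1 r m x * psi1 \<beta>0 \<beta>1 r m y) has_sum \<kappa> (x - y)) UNIV"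
proof -
  let ?g = "\<lambda>m. psi1 \<beta>0 \<beta>1 r m x * psi1 \<beta>0 \<beta>1 r m y"
  let ?t = "\<lambda>k z. 2 * pi * real (Suc k) * z"
  have w_eq: "sqrt \<beta>1 * real (Suc k) powr (- r) * (sqrt \<beta>1 * real (Suc k) powr (- r)) = w k" for k
    using \<beta>1 by (simp add: w_def mult.assoc mult.left_commute flip: powr_add)
  have psi1_pos: "psi1 \<beta>0 \<beta>1 r (int n) z = sqrt \<beta>1 * real n powr (- r) * cos (2 * pi * real n * z)"
    and psi1_neg: "psi1 \<beta>0 \<beta>1 r (- int n) z = sqrt \<beta>1 * real n powr (- r) * sin (2 * pi * real n * z)"
    if "n > 0" for n :: nat and z
    using that by (simp_all add: psi1_def)
  have pos: "?g (int (Suc k)) = w k * (cos (?t k x) * cos (?t k y))" for k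
    unfolding psi1_pos[OF zero_less_Suc] w_eq[symmetric] by (simp only: mult.assoc mult.left_commute mult.commute)
  have neg: "?g (- int (Suc k)) = w k * (sin (?t k x) * sin (?t k y))" for k
    unfolding psi1_neg[OF zero_less_Suc] w_eq[symmetric] by (simp only: mult.assoc mult.left_commute mult.commute)
  have sp: "summable (\<lambda>k. \<bar>?g (int (Suc k))\<bar>)" "summable (\<lambda>k. \<bar>?g (- int (Suc k))\<bar>)"
    unfolding pos neg by (intro summable_w_bounded; simp add: abs_mult mult_le_one)+
  show "(\<lambda>m. \<bar>?g m\<bar>) summable_on UNIV"
    by (rule int_has_sum_split[OF sp])
  have "?g 0 + (\<Sum>k. ?g (int (Suc k)) + ?g (- int (Suc k))) = \<kappa> (x - y)"
  proof -
    have "w k * (cos (?t k x) * cos (?t k y)) + w k * (sin (?t k x) * sin (?t k y)) = w k * cos (?t k (x - y))" for k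
      using cos_diff[of "?t k x" "?t k y"] by (simp only: right_diff_distrib distrib_left)
    moreover have "?g 0 = \<beta>0"
      using \<beta>0 by (simp add: psi1_def)
    ultimately show ?thesis
      unfolding pos neg \<kappa>_def by (simp only:)
  qed
  with int_has_sum_split(2)[OF sp] show "(?g has_sum \<kappa> (x - y)) UNIV"
    by simp
qed

section \<open>Tensor product kernel and Hilbert space distances between points\<close>

abbreviation \<psi> :: "nat \<Rightarrow> (nat \<Rightarrow> int) \<Rightarrow> (nat \<Rightarrow> real) \<Rightarrow> real" where
  "\<psi> \<equiv> psi \<beta>0 \<beta>1 r"

lemma psi_mult_has_sum:
  "((\<lambda>k. \<psi> d k x * \<psi> d k y) has_sum (\<Prod>j<d. \<kappa> (x j - y j))) (Zd d)"
  unfolding psi_def prod.distrib[symmetric]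
  by (intro Zd_has_sum_prod(2) psi1_has_sum)

lemma psi_square_has_sum: "((\<lambda>k. (\<psi> d k x)\<^sup>2) has_sum 1) (Zd d)"
  using psi_mult_has_sum[of d x x] by (simp add: power2_eq_square kappa_0)

text \<open>The vectors of basis values at \<open>x\<close> and \<open>y\<close> are unit vectors
  whose inner product is the product kernel, so expanding the square leaves twice one minus that
  product, to which \<open>one_minus_prod_le\<close> applies.\<close>

lemma psi_diff_square:
  fixes d :: nat
  assumes "\<And>j. j < d \<Longrightarrow> \<bar>x j - y j\<bar> \<le> \<delta>" and "0 \<le> \<delta>"
  shows "(\<lambda>k. (\<psi> d k x - \<psi> d k y)\<^sup>2) summable_on Zd d"
    and "(\<Sum>\<^sub>\<infinity>k\<in>Zd d. (\<psi> d k x - \<psi> d k y)\<^sup>2) \<le> 2 * hoelder_const * (real d * \<delta> powr s)"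
proof -
  have "((\<lambda>k. (\<psi> d k x)\<^sup>2 + (\<psi> d k y)\<^sup>2 + - 2 * (\<psi> d k x * \<psi> d k y))
      has_sum (1 + 1 + - 2 * (\<Prod>j<d. \<kappa> (x j - y j)))) (Zd d)"
    by (intro has_sum_add has_sum_cmult_right psi_square_has_sum psi_mult_has_sum)
  moreover have "(\<psi> d k x)\<^sup>2 + (\<psi> d k y)\<^sup>2 + - 2 * (\<psi> d k x * \<psi> d k y) = (\<psi> d k x - \<psi> d k y)\<^sup>2" for k
    by (simp add: power2_diff)
  ultimately have *: "((\<lambda>k. (\<psi> d k x - \<psi> d k y)\<^sup>2) has_sum (2 * (1 - (\<Prod>j<d. \<kappa> (x j - y j))))) (Zd d)"
    by simp
  then show "(\<lambda>k. (\<psi> d k x - \<psi> d k y)\<^sup>2) summable_on Zd d"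
    by (rule has_sum_imp_summable)
  have "1 - (\<Prod>j<d. \<kappa> (x j - y j)) \<le> (\<Sum>j<d. 1 - \<kappa> (x j - y j))"
    by (rule one_minus_prod_le) (rule abs_kappa_le)
  also have "\<dots> \<le> (\<Sum>j<d. hoelder_const * \<delta> powr s)"
  proof (rule sum_mono)
    fix j assume "j \<in> {..<d}"
    then have "\<bar>x j - y j\<bar> powr s \<le> \<delta> powr s"
      using assms s_bounds by (intro powr_mono2) auto
    from mult_left_mono[OF this hoelder_const_nonneg] one_minus_kappa_le[of "x j - y j"]
    show "1 - \<kappa> (x j - y j) \<le> hoelder_const * \<delta> powr s" by linarith
  qed
  finally show "(\<Sum>\<^sub>\<infinity>k\<in>Zd d. (\<psi> d k x - \<psi> d k y)\<^sup>2) \<le> 2 * hoelder_const * (real d * \<delta> powr s)"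
    unfolding infsumI[OF *] by (simp add: mult_ac)
qed

end

subsection \<open>Exponential moments of random signs\<close>

lemma cosh_le_exp_square_half: "(exp x + exp (- x)) / 2 \<le> exp (x\<^sup>2 / 2)" for x :: real
proof -
  have *: "(exp y + exp (- y)) / 2 \<le> exp (y\<^sup>2 / 2)" if "y \<ge> 0" for y :: real
  proof -
    \<comment> \<open>Hoeffding's inequality for a fair two-point variable with values 0 and
      \<open>2 * y\<close>; multiplying by \<open>exp (- y)\<close> then centres it.\<close>
    have "ln ((1 + exp (2 * y)) / 2) \<le> y\<^sup>2 / 2 + y"
      using Hoeffdings_lemma_aux[of "2 * y" "1 / 2"] that by (simp add: field_simps power2_eq_square)
    then have "(1 + exp (2 * y)) / 2 \<le> exp (y\<^sup>2 / 2 + y)"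
      by (metis exp_gt_zero exp_le_cancel_iff exp_ln half_gt_zero add_pos_pos zero_less_one)
    then have "exp (- y) * ((1 + exp (2 * y)) / 2) \<le> exp (- y) * exp (y\<^sup>2 / 2 + y)"
      by (rule mult_left_mono) simp
    moreover have "exp (- y) * ((1 + exp (2 * y)) / 2) = (exp y + exp (- y)) / 2"
      by (simp add: algebra_simps add_divide_distrib flip: exp_add)
    moreover have "exp (- y) * exp (y\<^sup>2 / 2 + y) = exp (y\<^sup>2 / 2)"
      by (simp flip: exp_add)
    ultimately show ?thesis by simp
  qed
  show ?thesis
    using *[of x] *[of "- x"] by (cases "x \<ge> 0") (simp_all add: add.commute)
qed

text \<open>Taylor's formula with Lagrange remainder. The linear term is kept exact because it
  vanishes in expectation for a centred variable.\<close>

lemma exp_le_quadratic: "exp u \<le> 1 + u + u\<^sup>2 * exp \<bar>u\<bar>" for u :: real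
proof -
  obtain t where t: "\<bar>t\<bar> \<le> \<bar>u\<bar>" "exp u = (\<Sum>m<2. u ^ m / fact m) + exp t / fact 2 * u ^ 2"
    using Maclaurin_exp_le[of u 2] by blast
  have "exp t / 2 \<le> exp t" "exp t \<le> exp \<bar>u\<bar>"
    using t(1) by auto
  then have "exp t / 2 * u\<^sup>2 \<le> exp \<bar>u\<bar> * u\<^sup>2"
    by (intro mult_right_mono) (linarith, simp)
  with t(2) show ?thesis
    by (simp add: numeral_2_eq_2 mult.commute)
qed

section \<open>Random sign vectors and their moments\<close>

definition rademacher :: "real pmf" where
  "rademacher = pmf_of_set {-1, 1}"

definition signs :: "'a set \<Rightarrow> ('a \<Rightarrow> real) pmf" where
  "signs A = Pi_pmf A 0 (\<lambda>_. rademacher)"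

lemma finite_set_rademacher [simp]: "finite (set_pmf rademacher)"
  by (simp add: rademacher_def)

lemma expectation_rademacher: "measure_pmf.expectation rademacher f = (f 1 + f (- 1)) / (2 :: real)"
  by (simp add: rademacher_def integral_pmf_of_set)

lemma finite_set_Pi_pmf:
  assumes "finite A" and "\<And>x. x \<in> A \<Longrightarrow> finite (set_pmf (p x))"
  shows "finite (set_pmf (Pi_pmf A dflt p))"
  unfolding set_Pi_pmf[OF assms(1)] using assms by (intro finite_PiE_dflt) auto

lemma finite_set_signs [simp]: "finite A \<Longrightarrow> finite (set_pmf (signs A))"
  unfolding signs_def by (rule finite_set_Pi_pmf) auto

lemma expectation_signs_exp:
  fixes a :: "'a \<Rightarrow> real"
  assumes "finite A"
  shows "measure_pmf.expectation (signs A) (\<lambda>\<xi>. exp (\<Sum>k\<in>A. \<xi> k * a k)) \<le> exp ((\<Sum>k\<in>A. (a k)\<^sup>2) / 2)"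
proof -
  have "measure_pmf.expectation (signs A) (\<lambda>\<xi>. exp (\<Sum>k\<in>A. \<xi> k * a k))
      = (\<Prod>k\<in>A. measure_pmf.expectation rademacher (\<lambda>z. exp (z * a k)))"
    unfolding signs_def exp_sum[OF assms]
    by (rule expectation_prod_Pi_pmf[OF assms]) (auto intro: integrable_measure_pmf_finite)
  also have "\<dots> \<le> (\<Prod>k\<in>A. exp ((a k)\<^sup>2 / 2))"
    using cosh_le_exp_square_half by (intro prod_mono) (auto simp: expectation_rademacher)
  also have "\<dots> = exp ((\<Sum>k\<in>A. (a k)\<^sup>2) / 2)"
    by (simp add: exp_sum[OF assms] sum_divide_distrib)
  finally show ?thesis .
qed

text \<open>Conditioning on the sign of the new coordinate; it serves as the induction step for
  second moments.\<close>

lemma expectation_signs_insert: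
  assumes "finite A" "x \<notin> A"
  shows "measure_pmf.expectation (signs (insert x A)) f
    = (measure_pmf.expectation (signs A) (\<lambda>\<xi>. f (\<xi>(x := 1))) + measure_pmf.expectation (signs A) (\<lambda>\<xi>. f (\<xi>(x := - 1)))) / (2 :: real)"
proof -
  have "signs (insert x A) = bind_pmf rademacher (\<lambda>z. map_pmf (\<lambda>\<xi>. \<xi>(x := z)) (signs A))"
    unfolding signs_def Pi_pmf_insert'[OF assms] map_pmf_def ..
  moreover have "pmf rademacher 1 = 1 / 2" "pmf rademacher (- 1) = 1 / 2"
    by (simp_all add: rademacher_def)
  ultimately show ?thesis
    using assms by (simp add: pmf_expectation_bind[of "{1, - 1}"] rademacher_def scaleR_conv_of_real add_divide_distrib)
qed

text \<open>Isotropy of random signs, which is what makes the rank-one estimator unbiased on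
  \<open>A\<close>.\<close>

lemma expectation_signs_mult:
  fixes a b :: "'a \<Rightarrow> real"
  assumes "finite A"
  shows "measure_pmf.expectation (signs A) (\<lambda>\<xi>. (\<Sum>k\<in>A. \<xi> k * a k) * (\<Sum>k\<in>A. \<xi> k * b k)) = (\<Sum>k\<in>A. a k * b k)"
  using assms
proof (induction A)
  case empty
  show ?case by simp
next
  case (insert x A)
  let ?X = "\<lambda>\<xi>. \<Sum>k\<in>A. \<xi> k * a k" and ?Y = "\<lambda>\<xi>. \<Sum>k\<in>A. \<xi> k * b k"
  have int: "integrable (measure_pmf (signs A)) f" for f :: "_ \<Rightarrow> real"
    using insert by (intro integrable_measure_pmf_finite) simp
  have upd: "(\<Sum>k\<in>insert x A. (\<xi>(x := z)) k * c k) = z * c x + (\<Sum>k\<in>A. \<xi> k * c k)" for \<xi> z and c :: "'a \<Rightarrow> real"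
    using insert by (auto intro!: sum.cong)
  have "measure_pmf.expectation (signs (insert x A)) (\<lambda>\<xi>. (\<Sum>k\<in>insert x A. \<xi> k * a k) * (\<Sum>k\<in>insert x A. \<xi> k * b k))
     = (measure_pmf.expectation (signs A) (\<lambda>\<xi>. (1 * a x + ?X \<xi>) * (1 * b x + ?Y \<xi>))
        + measure_pmf.expectation (signs A) (\<lambda>\<xi>. (- 1 * a x + ?X \<xi>) * (- 1 * b x + ?Y \<xi>))) / 2"
    unfolding expectation_signs_insert[OF insert(1,2)] upd ..
  also have "\<dots> = measure_pmf.expectation (signs A) (\<lambda>\<xi>. a x * b x + ?X \<xi> * ?Y \<xi>)"
  proof -
    \<comment> \<open>The mixed terms carry the new sign exactly once and cancel between its two
      values.\<close>
    have "(1 * a x + ?X \<xi>) * (1 * b x + ?Y \<xi>) + (- 1 * a x + ?X \<xi>) * (- 1 * b x + ?Y \<xi>)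
        = 2 * (a x * b x + ?X \<xi> * ?Y \<xi>)" for \<xi>
      by (simp add: algebra_simps)
    then show ?thesis
      unfolding Bochner_Integration.integral_add[OF int int, symmetric]
      by (simp only: integral_mult_right_zero nonzero_mult_div_cancel_left[of 2] zero_neq_numeral[symmetric] not_False_eq_True)
  qed
  also have "\<dots> = a x * b x + (\<Sum>k\<in>A. a k * b k)"
    using insert.IH by (simp add: Bochner_Integration.integral_add[OF int int])
  finally show ?case using insert by simp
qed

text \<open>Subgaussian tails give exponential moments of the square: the terms of the exponential
  series are bounded by \<open>2 * (3 / 4) ^ m\<close>, whose sum is 8.\<close>

lemma expectation_signs_exp_square:
  fixes a :: "'a \<Rightarrow> real"
  assumes A: "finite A" and a: "(\<Sum>k\<in>A. (a k)\<^sup>2) \<le> 1"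
  shows "measure_pmf.expectation (signs A) (\<lambda>\<xi>. exp ((\<Sum>k\<in>A. \<xi> k * a k)\<^sup>2 / 4)) \<le> 8"
proof -
  define X where "X = (\<lambda>\<xi>. \<Sum>k\<in>A. \<xi> k * a k)"
  let ?E = "measure_pmf.expectation (signs A)"
  have int: "integrable (measure_pmf (signs A)) f" for f :: "_ \<Rightarrow> real"
    using A by (intro integrable_measure_pmf_finite) simp
  have E_eq: "?E f = (\<Sum>\<xi>\<in>set_pmf (signs A). f \<xi> * pmf (signs A) \<xi>)" for f :: "_ \<Rightarrow> real"
    using A by (intro integral_measure_pmf_real) auto
  have mgf: "?E (\<lambda>\<xi>. exp (t * X \<xi>)) \<le> exp (t\<^sup>2 / 2)" for t
  proof -
    have "?E (\<lambda>\<xi>. exp (t * X \<xi>)) \<le> exp ((\<Sum>k\<in>A. (t * a k)\<^sup>2) / 2)"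
      using expectation_signs_exp[OF A, of "\<lambda>k. t * a k"] by (simp add: X_def sum_distrib_left mult_ac)
    also have "(\<Sum>k\<in>A. (t * a k)\<^sup>2) = t\<^sup>2 * (\<Sum>k\<in>A. (a k)\<^sup>2)"
      by (simp add: power_mult_distrib sum_distrib_left)
    also have "\<dots> \<le> t\<^sup>2 * 1"
      using a by (intro mult_left_mono) auto
    finally show ?thesis by simp
  qed
  have moment: "?E (\<lambda>\<xi>. ((X \<xi>)\<^sup>2 / 4) ^ m /\<^sub>R fact m) \<le> 2 * (3 / 4) ^ m" for m
  proof (cases "m = 0")
    case False
    \<comment> \<open>This \<open>t\<close> minimises \<open>exp (t^2 / 2) / t ^ (2 * m)\<close>,
      the moment bound extracted from the moment generating function.\<close>
    define t where "t = sqrt (2 * real m)"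
    have t2: "t ^ (2 * m) = (2 * real m) ^ m"
      by (simp add: t_def power_mult)
    have *: "(t * X \<xi>) ^ (2 * m) \<le> fact (2 * m) * (exp (t * X \<xi>) + exp (- t * X \<xi>))" for \<xi>
    proof -
      have "\<bar>t * X \<xi>\<bar> ^ (2 * m) /\<^sub>R fact (2 * m) \<le> exp \<bar>t * X \<xi>\<bar>"
        unfolding exp_def
        using sum_le_suminf[OF summable_exp_generic[of "\<bar>t * X \<xi>\<bar>"], of "{2 * m}"] by auto
      then have "\<bar>t * X \<xi>\<bar> ^ (2 * m) \<le> fact (2 * m) * exp \<bar>t * X \<xi>\<bar>"
        by (simp add: field_simps)
      also have "exp \<bar>t * X \<xi>\<bar> \<le> exp (t * X \<xi>) + exp (- t * X \<xi>)"
        by (cases "t * X \<xi> \<ge> 0") auto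
      finally show ?thesis by (simp add: power_mult)
    qed
    have "(2 * real m) ^ m * ?E (\<lambda>\<xi>. X \<xi> ^ (2 * m)) = ?E (\<lambda>\<xi>. (t * X \<xi>) ^ (2 * m))"
      by (simp add: power_mult_distrib t2)
    also have "\<dots> \<le> ?E (\<lambda>\<xi>. fact (2 * m) * (exp (t * X \<xi>) + exp (- t * X \<xi>)))"
      by (intro integral_mono int *)
    also have "\<dots> = fact (2 * m) * (?E (\<lambda>\<xi>. exp (t * X \<xi>)) + ?E (\<lambda>\<xi>. exp (- t * X \<xi>)))"
      by (simp add: Bochner_Integration.integral_add[OF int int])
    also have "\<dots> \<le> fact (2 * m) * (exp (t\<^sup>2 / 2) + exp ((- t)\<^sup>2 / 2))"
      by (intro mult_left_mono add_mono mgf) simp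
    also have "\<dots> = 2 * fact (2 * m) * exp 1 ^ m"
      by (simp add: t_def flip: exp_of_nat_mult)
    \<comment> \<open>The quotient of \<open>fact (2 * m)\<close> by \<open>fact m\<close> is at
      most \<open>(2 * m) ^ m\<close>, which cancels against \<open>t ^ (2 * m)\<close>. What is
      left is \<open>fact m\<close> times a power of \<open>exp 1\<close>, and bounding
      \<open>exp 1\<close> by 3 suffices because 3 is below the 4 in the exponent.\<close>
    also have "\<dots> \<le> 2 * ((2 * real m) ^ m * fact m) * 3 ^ m"
    proof -
      have "fact (2 * m) div fact (2 * m - m) \<le> (2 * m) ^ m"
        by (rule fact_div_fact_le_pow) simp
      moreover have "fact (2 * m) = fact (2 * m) div fact m * (fact m :: nat)"
        by (simp add: fact_dvd)
      ultimately have "fact (2 * m) \<le> (2 * m) ^ m * (fact m :: nat)"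
        by (metis diff_add_inverse mult_2 mult_le_mono1)
      then have "real (fact (2 * m)) \<le> real ((2 * m) ^ m * fact m)"
        by (rule of_nat_mono)
      then have "2 * fact (2 * m) \<le> 2 * ((2 * real m) ^ m * fact m)"
        by simp
      moreover have "exp 1 ^ m \<le> (3 :: real) ^ m"
        by (intro power_mono exp_le) simp
      ultimately show ?thesis
        by (rule mult_mono) auto
    qed
    finally have "?E (\<lambda>\<xi>. X \<xi> ^ (2 * m)) \<le> 2 * fact m * 3 ^ m"
      using False by (simp add: mult_ac)
    moreover have "?E (\<lambda>\<xi>. ((X \<xi>)\<^sup>2 / 4) ^ m /\<^sub>R fact m) = ?E (\<lambda>\<xi>. X \<xi> ^ (2 * m)) / (fact m * 4 ^ m)"
      unfolding power_mult[of _ 2 m] by (simp add: power_divide field_simps)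
    ultimately show ?thesis
      by (simp add: field_simps)
  qed simp
  have "(\<lambda>m. \<Sum>\<xi>\<in>set_pmf (signs A). (((X \<xi>)\<^sup>2 / 4) ^ m /\<^sub>R fact m) * pmf (signs A) \<xi>)
      sums (\<Sum>\<xi>\<in>set_pmf (signs A). exp ((X \<xi>)\<^sup>2 / 4) * pmf (signs A) \<xi>)"
    by (intro sums_sum sums_mult2 exp_converges)
  then have "(\<lambda>m. ?E (\<lambda>\<xi>. ((X \<xi>)\<^sup>2 / 4) ^ m /\<^sub>R fact m)) sums ?E (\<lambda>\<xi>. exp ((X \<xi>)\<^sup>2 / 4))"
    unfolding E_eq .
  moreover have "(\<lambda>m. 2 * (3 / 4 :: real) ^ m) sums (2 * (1 / (1 - 3 / 4)))"
    by (intro sums_mult geometric_sums) simp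
  ultimately have "?E (\<lambda>\<xi>. exp ((X \<xi>)\<^sup>2 / 4)) \<le> 2 * (1 / (1 - 3 / 4))"
    using moment by (rule sums_le[rotated])
  then show ?thesis by (simp add: X_def)
qed

text \<open>The error of one rank-one sample: \<open>h\<close> is the vector of basis values at a
  point, or a difference of two such vectors, and the subtracted sum is the mean of the
  product.\<close>

definition centred_product :: "'a set \<Rightarrow> ('a \<Rightarrow> real) \<Rightarrow> ('a \<Rightarrow> real) \<Rightarrow> ('a \<Rightarrow> real) \<Rightarrow> real" where
  "centred_product A c h \<xi> = (\<Sum>k\<in>A. \<xi> k * c k) * (\<Sum>k\<in>A. \<xi> k * h k) - (\<Sum>k\<in>A. c k * h k)"

lemma abs_sum_mult_le_1:
  fixes c h :: "'a \<Rightarrow> real"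
  assumes "(\<Sum>k\<in>A. (c k)\<^sup>2) \<le> 1" and "(\<Sum>k\<in>A. (h k)\<^sup>2) \<le> 1"
  shows "\<bar>\<Sum>k\<in>A. c k * h k\<bar> \<le> 1"
proof -
  have "\<bar>\<Sum>k\<in>A. c k * h k\<bar> \<le> (\<Sum>k\<in>A. \<bar>c k\<bar> * \<bar>h k\<bar>)"
    by (rule order_trans[OF sum_abs]) (simp add: abs_mult)
  also have "\<dots> \<le> L2_set c A * L2_set h A"
    by (rule L2_set_mult_ineq)
  also have "\<dots> \<le> 1 * 1"
    using assms by (intro mult_mono) (auto simp: L2_set_def sum_nonneg)
  finally show ?thesis by simp
qed

text \<open>Products of two subgaussian variables are only subexponential, hence the restriction on
  \<open>t\<close>. In \<open>exp_le_quadratic\<close> the linear term has mean 0 and the quadratic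
  one is dominated by the two exponential squares of mean at most 8; the constant is
  \<open>192 * (8 + 8)\<close>.\<close>

lemma expectation_exp_centred_product:
  fixes c h :: "'a \<Rightarrow> real"
  assumes A: "finite A" and c: "(\<Sum>k\<in>A. (c k)\<^sup>2) \<le> 1" and h: "(\<Sum>k\<in>A. (h k)\<^sup>2) \<le> 1"
    and t: "\<bar>t\<bar> \<le> 1 / 8"
  shows "measure_pmf.expectation (signs A) (\<lambda>\<xi>. exp (t * centred_product A c h \<xi>)) \<le> exp (3072 * t\<^sup>2)"
proof -
  let ?E = "measure_pmf.expectation (signs A)"
  let ?X = "\<lambda>\<xi>. \<Sum>k\<in>A. \<xi> k * c k" and ?Y = "\<lambda>\<xi>. \<Sum>k\<in>A. \<xi> k * h k"
  let ?Z = "centred_product A c h"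
  have int: "integrable (measure_pmf (signs A)) f" for f :: "_ \<Rightarrow> real"
    using A by (intro integrable_measure_pmf_finite) simp
  have mean: "?E ?Z = 0"
    unfolding centred_product_def using expectation_signs_mult[OF A, of c h]
    by (simp add: Bochner_Integration.integral_diff[OF int int])
  have *: "exp (t * ?Z \<xi>) \<le> 1 + t * ?Z \<xi> + 192 * t\<^sup>2 * (exp ((?X \<xi>)\<^sup>2 / 4) + exp ((?Y \<xi>)\<^sup>2 / 4))" for \<xi>
  proof -
    define z where "z = \<bar>?Z \<xi>\<bar>"
    \<comment> \<open>Half of the exponent \<open>z / 4\<close> pays for the factor
      \<open>z^2\<close>, the other half for \<open>exp (\<bar>t\<bar> * z)\<close>; this is where
      \<open>1 / 8\<close> enters.\<close>
    have "1 + z / 8 + (z / 8)\<^sup>2 / 2 \<le> exp (z / 8)"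
      by (rule exp_lower_Taylor_quadratic) (simp add: z_def)
    then have "(z / 8)\<^sup>2 \<le> 2 * exp (z / 8)"
      unfolding z_def by (smt (verit) abs_ge_zero divide_nonneg_nonneg field_sum_of_halves)
    then have zz: "z\<^sup>2 \<le> 128 * exp (z / 8)"
      by (simp add: power_divide)
    have "z\<^sup>2 * exp (\<bar>t\<bar> * z) \<le> (128 * exp (z / 8)) * exp (z / 8)"
    proof (intro mult_mono zz)
      show "exp (\<bar>t\<bar> * z) \<le> exp (z / 8)"
        using mult_right_mono[OF t, of z] by (simp add: z_def)
    qed auto
    also have "\<dots> = 128 * exp (z / 4)"
      by (simp flip: exp_add)
    finally have "z\<^sup>2 * exp (\<bar>t\<bar> * z) \<le> 128 * exp (z / 4)" .
    moreover have "exp (z / 4) \<le> exp (1 + (?X \<xi>)\<^sup>2 / 8 + (?Y \<xi>)\<^sup>2 / 8)"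
    proof -
      have "z \<le> \<bar>?X \<xi> * ?Y \<xi>\<bar> + 1"
        using abs_sum_mult_le_1[OF c h] unfolding z_def centred_product_def by linarith
      moreover have "2 * \<bar>?X \<xi> * ?Y \<xi>\<bar> \<le> (?X \<xi>)\<^sup>2 + (?Y \<xi>)\<^sup>2"
        using sum_squares_bound[of "\<bar>?X \<xi>\<bar>" "\<bar>?Y \<xi>\<bar>"] by (simp add: abs_mult)
      ultimately show ?thesis by simp
    qed
    moreover have "exp (1 + (?X \<xi>)\<^sup>2 / 8 + (?Y \<xi>)\<^sup>2 / 8) = exp 1 * (exp ((?X \<xi>)\<^sup>2 / 8) * exp ((?Y \<xi>)\<^sup>2 / 8))"
      by (simp add: exp_add)
    \<comment> \<open>The product is split into a sum by the arithmetic-geometric mean inequality,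
      giving the constant \<open>128 * 3 / 2 = 192\<close>.\<close>
    moreover have "exp 1 * (exp ((?X \<xi>)\<^sup>2 / 8) * exp ((?Y \<xi>)\<^sup>2 / 8)) \<le> 3 * ((exp ((?X \<xi>)\<^sup>2 / 4) + exp ((?Y \<xi>)\<^sup>2 / 4)) / 2)"
    proof (intro mult_mono exp_le)
      have e: "exp (x / 4) = (exp (x / 8))\<^sup>2" for x :: real
        by (simp add: power2_eq_square flip: exp_add)
      show "exp ((?X \<xi>)\<^sup>2 / 8) * exp ((?Y \<xi>)\<^sup>2 / 8) \<le> (exp ((?X \<xi>)\<^sup>2 / 4) + exp ((?Y \<xi>)\<^sup>2 / 4)) / 2"
        unfolding e using sum_squares_bound[of "exp ((?X \<xi>)\<^sup>2 / 8)" "exp ((?Y \<xi>)\<^sup>2 / 8)"] by simp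
    qed auto
    ultimately have "z\<^sup>2 * exp (\<bar>t\<bar> * z) \<le> 192 * (exp ((?X \<xi>)\<^sup>2 / 4) + exp ((?Y \<xi>)\<^sup>2 / 4))"
      by linarith
    then have "t\<^sup>2 * (z\<^sup>2 * exp (\<bar>t\<bar> * z)) \<le> t\<^sup>2 * (192 * (exp ((?X \<xi>)\<^sup>2 / 4) + exp ((?Y \<xi>)\<^sup>2 / 4)))"
      by (rule mult_left_mono) simp
    moreover have "t\<^sup>2 * (z\<^sup>2 * exp (\<bar>t\<bar> * z)) = (t * ?Z \<xi>)\<^sup>2 * exp \<bar>t * ?Z \<xi>\<bar>"
      by (simp add: z_def abs_mult power_mult_distrib)
    moreover have "t\<^sup>2 * (192 * x) = 192 * t\<^sup>2 * x" for x
      by simp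
    ultimately have "(t * ?Z \<xi>)\<^sup>2 * exp \<bar>t * ?Z \<xi>\<bar> \<le> 192 * t\<^sup>2 * (exp ((?X \<xi>)\<^sup>2 / 4) + exp ((?Y \<xi>)\<^sup>2 / 4))"
      by metis
    with exp_le_quadratic[of "t * ?Z \<xi>"] show ?thesis by linarith
  qed
  have "?E (\<lambda>\<xi>. exp (t * ?Z \<xi>))
      \<le> ?E (\<lambda>\<xi>. 1 + t * ?Z \<xi> + 192 * t\<^sup>2 * (exp ((?X \<xi>)\<^sup>2 / 4) + exp ((?Y \<xi>)\<^sup>2 / 4)))"
    by (intro integral_mono int *)
  also have "\<dots> = 1 + t * ?E ?Z + 192 * t\<^sup>2 * (?E (\<lambda>\<xi>. exp ((?X \<xi>)\<^sup>2 / 4)) + ?E (\<lambda>\<xi>. exp ((?Y \<xi>)\<^sup>2 / 4)))"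
    by (simp add: Bochner_Integration.integral_add[OF int int])
  also have "\<dots> = 1 + 192 * t\<^sup>2 * (?E (\<lambda>\<xi>. exp ((?X \<xi>)\<^sup>2 / 4)) + ?E (\<lambda>\<xi>. exp ((?Y \<xi>)\<^sup>2 / 4)))"
    unfolding mean by simp
  also have "\<dots> \<le> 1 + 192 * t\<^sup>2 * (8 + 8)"
    by (intro add_left_mono mult_left_mono add_mono expectation_signs_exp_square A c h) auto
  also have "\<dots> = 1 + 3072 * t\<^sup>2"
    by simp
  also have "\<dots> \<le> exp (3072 * t\<^sup>2)"
    by (rule exp_ge_add_one_self)
  finally show ?thesis .
qed

definition sign_matrix :: "nat \<Rightarrow> 'a set \<Rightarrow> (nat \<Rightarrow> 'a \<Rightarrow> real) pmf" where
  "sign_matrix n A = Pi_pmf {..<n} (\<lambda>_. 0) (\<lambda>_. signs A)"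

lemma finite_set_sign_matrix [simp]: "finite A \<Longrightarrow> finite (set_pmf (sign_matrix n A))"
  unfolding sign_matrix_def by (rule finite_set_Pi_pmf) auto

text \<open>Independence of the rows multiplies the single-sample bounds; the factor 2 comes from
  using both signs of \<open>t\<close> to reach the absolute value.\<close>

lemma expectation_exp_sum_centred_product:
  fixes c h :: "'a \<Rightarrow> real"
  assumes A: "finite A" and c: "(\<Sum>k\<in>A. (c k)\<^sup>2) \<le> 1" and h: "(\<Sum>k\<in>A. (h k)\<^sup>2) \<le> 1"
    and t: "0 \<le> t" "t \<le> 1 / 8"
  shows "measure_pmf.expectation (sign_matrix n A) (\<lambda>\<omega>. exp (t * \<bar>\<Sum>i<n. centred_product A c h (\<omega> i)\<bar>))
    \<le> 2 * exp (3072 * real n * t\<^sup>2)"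
proof -
  let ?E = "measure_pmf.expectation (sign_matrix n A)"
  let ?S = "\<lambda>\<omega>. \<Sum>i<n. centred_product A c h (\<omega> i)"
  have int: "integrable (measure_pmf (sign_matrix n A)) f" for f :: "_ \<Rightarrow> real"
    using A by (intro integrable_measure_pmf_finite) simp
  have *: "?E (\<lambda>\<omega>. exp (u * ?S \<omega>)) \<le> exp (3072 * real n * t\<^sup>2)" if u: "\<bar>u\<bar> = t" for u
  proof -
    have "?E (\<lambda>\<omega>. exp (u * ?S \<omega>)) = ?E (\<lambda>\<omega>. \<Prod>i<n. exp (u * centred_product A c h (\<omega> i)))"
      by (simp add: sum_distrib_left exp_sum)
    also have "\<dots> = (\<Prod>i<n. measure_pmf.expectation (signs A) (\<lambda>\<xi>. exp (u * centred_product A c h \<xi>)))"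
      unfolding sign_matrix_def
      by (rule expectation_prod_Pi_pmf) (use A in \<open>auto intro: integrable_measure_pmf_finite\<close>)
    also have "\<dots> \<le> (\<Prod>i<n. exp (3072 * u\<^sup>2))"
      using u t by (intro prod_mono conjI expectation_exp_centred_product A c h) (auto intro: Bochner_Integration.integral_nonneg)
    also have "\<dots> = exp (3072 * real n * t\<^sup>2)"
      using power2_abs[of u] unfolding u by (simp add: mult_ac flip: exp_of_nat_mult)
    finally show ?thesis .
  qed
  have "?E (\<lambda>\<omega>. exp (t * \<bar>?S \<omega>\<bar>)) \<le> ?E (\<lambda>\<omega>. exp (t * ?S \<omega>) + exp (- t * ?S \<omega>))"
    by (intro integral_mono int) (auto simp: abs_if)
  also have "\<dots> = ?E (\<lambda>\<omega>. exp (t * ?S \<omega>)) + ?E (\<lambda>\<omega>. exp (- t * ?S \<omega>))"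
    by (rule Bochner_Integration.integral_add[OF int int])
  also have "\<dots> \<le> exp (3072 * real n * t\<^sup>2) + exp (3072 * real n * t\<^sup>2)"
    using t by (intro add_mono *) auto
  finally show ?thesis by simp
qed

text \<open>The uniform bound \<open>U\<close> comes from \<open>y \<le> a + exp (y - a)\<close>, with the exponentials summed over
  \<open>T\<close> and \<open>a\<close> the logarithm of a bound on the expectation of that sum.\<close>

lemma sup_centred_product_bound:
  fixes c :: "'a \<Rightarrow> real" and h :: "'t \<Rightarrow> 'a \<Rightarrow> real"
  assumes A: "finite A" and c: "(\<Sum>k\<in>A. (c k)\<^sup>2) \<le> 1"
    and T: "finite T" "real (card T) \<le> N" "1 \<le> N"
    and h: "\<And>t. t \<in> T \<Longrightarrow> (\<Sum>k\<in>A. (h t k)\<^sup>2) \<le> \<sigma>\<^sup>2" and "0 < \<sigma>"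
    and \<tau>: "0 < \<tau>" "\<tau> \<le> 1 / 8"
  shows "\<exists>U. (\<forall>\<omega>. \<forall>t\<in>T. \<bar>\<Sum>i<n. centred_product A c (h t) (\<omega> i)\<bar> \<le> U \<omega>) \<and>
    measure_pmf.expectation (sign_matrix n A) U \<le> \<sigma> * (ln (2 * N) + 3072 * real n * \<tau>\<^sup>2 + 1) / \<tau>"
proof -
  let ?E = "measure_pmf.expectation (sign_matrix n A)"
  \<comment> \<open>Division by \<open>\<sigma>\<close> moves the vectors into the unit ball;
    linearity in \<open>h\<close> restores the factor at the end.\<close>
  define v where "v t \<omega> = (\<Sum>i<n. centred_product A c (\<lambda>k. h t k / \<sigma>) (\<omega> i))" for t \<omega>
  define a where "a = ln (2 * N) + 3072 * real n * \<tau>\<^sup>2"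
  define U where "U \<omega> = \<sigma> / \<tau> * (a + (\<Sum>t\<in>T. exp (\<tau> * \<bar>v t \<omega>\<bar>)) * exp (- a))" for \<omega>
  have int: "integrable (measure_pmf (sign_matrix n A)) f" for f :: "_ \<Rightarrow> real"
    using A by (intro integrable_measure_pmf_finite) simp
  have scale: "(\<Sum>i<n. centred_product A c (h t) (\<omega> i)) = \<sigma> * v t \<omega>" for t \<omega>
    using \<open>0 < \<sigma>\<close> unfolding v_def centred_product_def
    by (simp add: sum_distrib_left right_diff_distrib mult.left_commute[of \<sigma>])
  have "\<bar>\<sigma> * v t \<omega>\<bar> \<le> U \<omega>" if "t \<in> T" for t \<omega>
  proof -
    have "\<tau> * \<bar>v t \<omega>\<bar> \<le> a + exp (\<tau> * \<bar>v t \<omega>\<bar> - a)"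
      using exp_ge_add_one_self[of "\<tau> * \<bar>v t \<omega>\<bar> - a"] by linarith
    also have "exp (\<tau> * \<bar>v t \<omega>\<bar> - a) = exp (\<tau> * \<bar>v t \<omega>\<bar>) * exp (- a)"
      by (simp flip: exp_add)
    also have "\<dots> \<le> (\<Sum>t\<in>T. exp (\<tau> * \<bar>v t \<omega>\<bar>)) * exp (- a)"
      using T that by (intro mult_right_mono member_le_sum) auto
    finally have "\<sigma> / \<tau> * (\<tau> * \<bar>v t \<omega>\<bar>) \<le> U \<omega>"
      unfolding U_def using \<open>0 < \<sigma>\<close> \<tau> by (intro mult_left_mono) auto
    then show ?thesis using \<open>0 < \<sigma>\<close> \<tau> by (simp add: abs_mult)
  qed
  moreover have "?E U \<le> \<sigma> * (ln (2 * N) + 3072 * real n * \<tau>\<^sup>2 + 1) / \<tau>"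
  proof -
    have "?E (\<lambda>\<omega>. exp (\<tau> * \<bar>v t \<omega>\<bar>)) \<le> 2 * exp (3072 * real n * \<tau>\<^sup>2)" if "t \<in> T" for t
    proof -
      have "(\<Sum>k\<in>A. (h t k / \<sigma>)\<^sup>2) = (\<Sum>k\<in>A. (h t k)\<^sup>2) / \<sigma>\<^sup>2"
        by (simp add: power_divide sum_divide_distrib)
      also have "\<dots> \<le> 1" using h[OF that] \<open>0 < \<sigma>\<close> by simp
      finally show ?thesis
        unfolding v_def using \<tau> by (intro expectation_exp_sum_centred_product A c) auto
    qed
    then have "(\<Sum>t\<in>T. ?E (\<lambda>\<omega>. exp (\<tau> * \<bar>v t \<omega>\<bar>))) \<le> real (card T) * (2 * exp (3072 * real n * \<tau>\<^sup>2))"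
      by (rule sum_bounded_above)
    also have "\<dots> \<le> N * (2 * exp (3072 * real n * \<tau>\<^sup>2))"
      using T by (intro mult_right_mono) auto
    also have "\<dots> = exp a"
      using T by (simp add: a_def exp_add)
    finally have "(\<Sum>t\<in>T. ?E (\<lambda>\<omega>. exp (\<tau> * \<bar>v t \<omega>\<bar>))) * exp (- a) \<le> exp a * exp (- a)"
      by (rule mult_right_mono) simp
    then have "(\<Sum>t\<in>T. ?E (\<lambda>\<omega>. exp (\<tau> * \<bar>v t \<omega>\<bar>))) * exp (- a) \<le> 1"
      by (simp flip: exp_add)
    moreover have "?E U = \<sigma> / \<tau> * (a + (\<Sum>t\<in>T. ?E (\<lambda>\<omega>. exp (\<tau> * \<bar>v t \<omega>\<bar>))) * exp (- a))"
      unfolding U_def by (simp add: Bochner_Integration.integral_add[OF int int] Bochner_Integration.integral_sum[OF int])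
    ultimately have "?E U \<le> \<sigma> / \<tau> * (a + 1)"
      using \<open>0 < \<sigma>\<close> \<tau> by (simp add: mult_left_mono divide_right_mono)
    then show ?thesis by (simp add: a_def)
  qed
  ultimately show ?thesis
    unfolding scale by blast
qed

subsection \<open>Chaining over dyadic grids\<close>

text \<open>Coordinates beyond \<open>d\<close> are sent to 0, so that the rounded points of the
  cube form a finite set.\<close>

definition dyadic_floor :: "nat \<Rightarrow> nat \<Rightarrow> (nat \<Rightarrow> real) \<Rightarrow> nat \<Rightarrow> real" where
  "dyadic_floor d l x j = (if j < d then real_of_int \<lfloor>2 ^ l * x j\<rfloor> / 2 ^ l else 0)"

definition grid :: "nat \<Rightarrow> nat \<Rightarrow> (nat \<Rightarrow> real) set" where
  "grid d l = (\<lambda>m j. if j < d then real (m j) / 2 ^ l else 0) ` ({..<d} \<rightarrow>\<^sub>E {..<2 ^ l :: nat})"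

text \<open>Coordinates beyond \<open>d\<close> are left free, so the cube contains the space of
  \<open>torus_measure d\<close>, whose points are \<open>undefined\<close> there.\<close>

definition cube :: "nat \<Rightarrow> (nat \<Rightarrow> real) set" where
  "cube d = {x. \<forall>j<d. 0 \<le> x j \<and> x j < 1}"

lemma finite_grid [simp]: "finite (grid d l)"
  unfolding grid_def by (intro finite_imageI finite_PiE) auto

lemma card_grid_le: "real (card (grid d l)) \<le> 2 ^ (l * d)"
proof -
  have "card (grid d l) \<le> card ({..<d} \<rightarrow>\<^sub>E {..<2 ^ l :: nat})"
    unfolding grid_def by (intro card_image_le finite_PiE) auto
  also have "\<dots> = 2 ^ (l * d)"
    by (simp add: card_PiE power_mult)
  finally show ?thesis
    by (metis of_nat_le_iff of_nat_numeral of_nat_power)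
qed

lemma dyadic_floor_bounds: "j < d \<Longrightarrow> dyadic_floor d l x j \<le> x j \<and> x j < dyadic_floor d l x j + (1 / 2) ^ l"
proof -
  assume "j < d"
  have "real_of_int \<lfloor>2 ^ l * x j\<rfloor> \<le> 2 ^ l * x j" "2 ^ l * x j < real_of_int \<lfloor>2 ^ l * x j\<rfloor> + 1"
    by linarith+
  then show ?thesis
    using \<open>j < d\<close> by (simp add: dyadic_floor_def field_simps power_one_over)
qed

lemma dyadic_floor_in_grid:
  assumes "x \<in> cube d"
  shows "dyadic_floor d l x \<in> grid d l"
  unfolding grid_def
proof (rule image_eqI)
  let ?m = "\<lambda>j\<in>{..<d}. nat \<lfloor>2 ^ l * x j\<rfloor>"
  have *: "0 \<le> \<lfloor>2 ^ l * x j\<rfloor>" "\<lfloor>2 ^ l * x j\<rfloor> < 2 ^ l" if "j < d" for j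
    using assms that by (auto simp: cube_def floor_less_iff)
  show "dyadic_floor d l x = (\<lambda>j. if j < d then real (?m j) / 2 ^ l else 0)"
    using * by (auto simp: dyadic_floor_def fun_eq_iff)
  show "?m \<in> {..<d} \<rightarrow>\<^sub>E {..<2 ^ l}"
    using * by (auto simp: nat_less_iff)
qed

text \<open>In each coordinate both rounded values lie at or below that of \<open>x\<close>, by less
  than \<open>(1 / 2) ^ l\<close>.\<close>

lemma dyadic_floor_diff_le:
  assumes "j < d"
  shows "\<bar>x j - dyadic_floor d l x j\<bar> \<le> (1 / 2) ^ l"
    and "\<bar>dyadic_floor d (Suc l) x j - dyadic_floor d l x j\<bar> \<le> (1 / 2) ^ l"
proof -
  have "(1 / 2 :: real) ^ Suc l \<le> (1 / 2) ^ l" by simp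
  then show "\<bar>x j - dyadic_floor d l x j\<bar> \<le> (1 / 2) ^ l"
    and "\<bar>dyadic_floor d (Suc l) x j - dyadic_floor d l x j\<bar> \<le> (1 / 2) ^ l"
    using dyadic_floor_bounds[OF assms, of l x] dyadic_floor_bounds[OF assms, of "Suc l" x] by linarith+
qed

lemma centred_product_diff:
  "centred_product A c (\<lambda>k. h k - h' k) \<xi> = centred_product A c h \<xi> - centred_product A c h' \<xi>"
  by (simp add: centred_product_def algebra_simps sum_subtractf)

section \<open>Levels, decay rate and constants of the chain\<close>

context korobov
begin

definition cost :: "nat \<Rightarrow> real" where
  "cost d = real d * (1 + ln (real d))"

lemma cost_ge_1:
  assumes "d \<ge> 1"
  shows "1 \<le> cost d"
proof -
  have "1 * 1 \<le> real d * (1 + ln (real d))"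
    using assms by (intro mult_mono) auto
  then show ?thesis by (simp add: cost_def)
qed

text \<open>For \<open>d \<ge> 1\<close> the least level \<open>l\<close> with
  \<open>2 powr (l * s) \<ge> d\<close>. From here on the increments are bounded independently of
  \<open>d\<close>, while the grid has only \<open>exp (O(cost d))\<close> points.\<close>

definition base_level :: "nat \<Rightarrow> nat" where
  "base_level d = nat \<lceil>ln (real d) / (s * ln 2)\<rceil>"

lemma half_power_powr: "((1 / 2) ^ l) powr s = exp (- (s * ln 2 * real l))"
  by (simp add: powr_def ln_realpow ln_div)

lemma base_level_ge:
  assumes "d \<ge> 1"
  shows "real d * ((1 / 2) ^ base_level d) powr s \<le> 1"
proof -
  have "ln (real d) / (s * ln 2) \<le> real (base_level d)"
    unfolding base_level_def by linarith
  then have "ln (real d) \<le> s * ln 2 * real (base_level d)"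
    using s_bounds by (simp add: field_simps)
  then have "exp (ln (real d)) \<le> exp (s * ln 2 * real (base_level d))"
    by (simp only: exp_le_cancel_iff)
  then show ?thesis
    using assms unfolding half_power_powr exp_minus by (simp add: field_simps)
qed

definition level_const :: real where
  "level_const = 4 + 2 / (s * ln 2)"

text \<open>With \<open>l = base_level d + j\<close> there are at most
  \<open>2 ^ (d * (2 * l + 1))\<close> pairs of points from the grids of levels \<open>l + 1\<close>
  and \<open>l\<close>. The left side dominates this exponent plus 1; the base level accounts for
  the logarithm in \<open>cost d\<close>.\<close>

lemma level_le:
  assumes "d \<ge> 1"
  shows "real d * (2 * real (base_level d + j) + 2) \<le> level_const * cost d * real (Suc j)"
proof -
  define K where "K = 2 / (s * ln 2)"
  have ln: "0 \<le> ln (real d)" using assms by simp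
  have K: "0 \<le> K" using s_bounds by (simp add: K_def)
  define q where "q = ln (real d) / (s * ln 2)"
  have "0 \<le> q" using ln s_bounds by (simp add: q_def)
  then have "real (base_level d) \<le> q + 1"
    unfolding base_level_def q_def[symmetric] by linarith
  moreover have "K * ln (real d) = 2 * q"
    by (simp add: K_def q_def)
  ultimately have "2 * real (base_level d + j) + 2 \<le> 4 + 2 * real j + K * ln (real d)"
    by simp
  also have "\<dots> \<le> (4 + K) * real (Suc j) * (1 + ln (real d))"
  proof -
    have "0 \<le> K + K * real j + K * (real j * ln (real d)) + 4 * (real j * ln (real d)) + 4 * ln (real d) + 2 * real j"
      using ln K by (intro add_nonneg_nonneg mult_nonneg_nonneg) auto
    then show ?thesis by (simp add: algebra_simps)
  qed
  also have "4 + K = level_const"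
    unfolding K_def level_const_def ..
  finally have "real d * (2 * real (base_level d + j) + 2) \<le> real d * (level_const * real (Suc j) * (1 + ln (real d)))"
    by (rule mult_left_mono) simp
  then show ?thesis unfolding cost_def by (simp only: mult_ac)
qed

text \<open>Equal to \<open>2 powr (- s / 2)\<close>, the contraction of the Hilbert space distance
  bound when the mesh width is halved.\<close>

definition ratio :: real where
  "ratio = exp (- (s * ln 2 / 2))"

lemma level_decay:
  assumes d: "d \<ge> 1"
  shows "real d * ((1 / 2) ^ (base_level d + j)) powr s \<le> (ratio ^ j)\<^sup>2"
proof -
  have "real d * ((1 / 2) ^ (base_level d + j)) powr s = (real d * ((1 / 2) ^ base_level d) powr s) * ((1 / 2) ^ j) powr s"
  proof -
    have "- (s * ln 2 * real (base_level d + j)) = - (s * ln 2 * real (base_level d)) + - (s * ln 2 * real j)"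
      by (simp add: distrib_left)
    then show ?thesis
      unfolding half_power_powr by (simp only: exp_add mult.assoc)
  qed
  also have "\<dots> \<le> 1 * ((1 / 2) ^ j) powr s"
    by (rule mult_right_mono[OF base_level_ge[OF d]]) simp
  also have "1 * ((1 / 2) ^ j) powr s = (ratio ^ j)\<^sup>2"
    unfolding half_power_powr ratio_def by (simp add: algebra_simps flip: exp_of_nat_mult)
  finally show ?thesis .
qed

text \<open>The summand 1 ensures positivity, so that the increments can be normalised.\<close>

definition scale :: real where
  "scale = sqrt (2 * hoelder_const + 1)"

text \<open>The 8 is the one in the choice of \<open>\<tau>\<close>, and 49 collects
  \<open>3072 / 64 = 48\<close> and the 1 of the uniform bound. The last factor adds the base level
  and the sum of \<open>scale * (j + 1) * ratio ^ j\<close> over all increments.\<close>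

definition chain_const :: real where
  "chain_const = 8 * (level_const + 49) * (1 + scale / (1 - ratio)\<^sup>2)"

lemma ratio_bounds: "0 < ratio" "ratio < 1"
  using s_bounds by (simp_all add: ratio_def)

lemma scale_bounds: "1 \<le> scale" "0 < scale"
  using hoelder_const_nonneg by (simp_all add: scale_def)

lemma chain_const_ge_1: "1 \<le> chain_const"
proof -
  have "0 \<le> level_const" using s_bounds by (simp add: level_const_def)
  moreover have "0 \<le> scale / (1 - ratio)\<^sup>2" using scale_bounds by simp
  ultimately have "1 * 1 \<le> (8 * (level_const + 49)) * (1 + scale / (1 - ratio)\<^sup>2)"
    by (intro mult_mono) auto
  then show ?thesis by (simp add: chain_const_def)
qed

text \<open>Chaining over the dyadic grids: the increments at level \<open>base_level d + j\<close> have squared norm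
  \<open>O(ratio ^ (2 * j))\<close>, while the logarithm of their number grows linearly in \<open>j\<close>, so one exponent
  \<open>\<tau>\<close> serves all levels.\<close>

lemma chaining:
  assumes A: "finite A" "A \<subseteq> Zd d" and c: "(\<Sum>k\<in>A. (c k)\<^sup>2) \<le> 1"
    and d: "d \<ge> 1" and n: "cost d \<le> real n"
  shows "\<exists>U. (\<forall>\<omega>. \<forall>x\<in>cube d.
      \<bar>\<Sum>i<n. centred_product A c (\<lambda>k. \<psi> d k (dyadic_floor d (base_level d + J) x)) (\<omega> i)\<bar> \<le> U \<omega>) \<and>
    measure_pmf.expectation (sign_matrix n A) U \<le> chain_const * sqrt (real n * cost d)"
proof -
  let ?E = "measure_pmf.expectation (sign_matrix n A)"
  let ?b = "base_level d" and ?D = "cost d"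
  have int: "integrable (measure_pmf (sign_matrix n A)) f" for f :: "_ \<Rightarrow> real"
    using A by (intro integrable_measure_pmf_finite) simp
  define S where "S h \<omega> = (\<Sum>i<n. centred_product A c h (\<omega> i))" for h \<omega>
  \<comment> \<open>Balances \<open>cost d / \<tau>\<close> against \<open>real n * \<tau>\<close>
    up to constants; the divisor 8 together with \<open>cost d \<le> real n\<close> gives
    \<open>\<tau> \<le> 1 / 8\<close>.\<close>
  define \<tau> where "\<tau> = sqrt (?D / real n) / 8"
  have D: "1 \<le> ?D" using cost_ge_1[OF d] .
  then have n0: "0 < real n" using n by linarith
  have \<tau>: "0 < \<tau>" "\<tau> \<le> 1 / 8"
    using D n n0 by (auto simp: \<tau>_def)
  have n\<tau>: "3072 * real n * \<tau>\<^sup>2 = 48 * ?D"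
    using D n0 by (simp add: \<tau>_def power_divide)
  have D\<tau>: "?D / \<tau> = 8 * sqrt (real n * ?D)"
  proof -
    have "?D = sqrt ?D * sqrt ?D" using D by simp
    then show ?thesis using D n0 by (simp add: \<tau>_def real_sqrt_divide real_sqrt_mult field_simps)
  qed
  \<comment> \<open>Turns the uniform bound for \<open>2 ^ m\<close> vectors of norm
    \<open>\<sigma>\<close> into a multiple of \<open>sqrt (real n * cost d)\<close>;
    \<open>R\<close> is the growth of the log-cardinality, namely \<open>Suc j\<close> at level
    \<open>j\<close>.\<close>
  have level: "\<sigma> * (ln (2 * 2 ^ m) + 3072 * real n * \<tau>\<^sup>2 + 1) / \<tau>
      \<le> \<sigma> * (8 * (level_const + 49) * R) * sqrt (real n * ?D)"
    if m: "real m + 1 \<le> level_const * ?D * R" and "1 \<le> R" "0 < \<sigma>" for m R \<sigma>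
  proof -
    have "ln (2 * 2 ^ m :: real) = (real m + 1) * ln 2"
      by (simp add: ln_mult ln_realpow algebra_simps)
    also have "\<dots> \<le> (real m + 1) * 1"
      using ln_2_less_1 by (intro mult_left_mono) auto
    also have "\<dots> \<le> level_const * ?D * R"
      using m by simp
    finally have "ln (2 * 2 ^ m) + 3072 * real n * \<tau>\<^sup>2 + 1 \<le> level_const * ?D * R + 49 * ?D"
      unfolding n\<tau> using D by linarith
    also have "\<dots> \<le> level_const * ?D * R + 49 * ?D * R"
      using D \<open>1 \<le> R\<close> by (simp add: mult_left_mono)
    also have "\<dots> = (level_const + 49) * R * ?D"
      by (simp add: algebra_simps)
    finally have "ln (2 * 2 ^ m) + 3072 * real n * \<tau>\<^sup>2 + 1 \<le> (level_const + 49) * R * ?D" .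
    then have "\<sigma> * (ln (2 * 2 ^ m) + 3072 * real n * \<tau>\<^sup>2 + 1) / \<tau> \<le> \<sigma> * ((level_const + 49) * R * ?D) / \<tau>"
      using \<tau> that by (intro divide_right_mono mult_left_mono) auto
    also have "\<dots> = \<sigma> * (level_const + 49) * R * (?D / \<tau>)"
      by simp
    also have "\<dots> = \<sigma> * (8 * (level_const + 49) * R) * sqrt (real n * ?D)"
      unfolding D\<tau> by (simp only: mult_ac)
    finally show ?thesis .
  qed
  obtain U0 where U0: "\<And>\<omega> y. y \<in> grid d ?b \<Longrightarrow> \<bar>S (\<lambda>k. \<psi> d k y) \<omega>\<bar> \<le> U0 \<omega>"
      and EU0: "?E U0 \<le> 8 * (level_const + 49) * sqrt (real n * ?D)"
  proof -
    have "(\<Sum>k\<in>A. (\<psi> d k y)\<^sup>2) \<le> 1\<^sup>2" for y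
      using finite_sum_le_has_sum[OF psi_square_has_sum A] by simp
    then have "\<exists>U. (\<forall>\<omega>. \<forall>y\<in>grid d ?b. \<bar>\<Sum>i<n. centred_product A c (\<lambda>k. \<psi> d k y) (\<omega> i)\<bar> \<le> U \<omega>) \<and>
        ?E U \<le> 1 * (ln (2 * 2 ^ (?b * d)) + 3072 * real n * \<tau>\<^sup>2 + 1) / \<tau>"
      by (intro sup_centred_product_bound A(1) c finite_grid card_grid_le \<tau>) simp_all
    then obtain U where U: "\<And>\<omega> y. y \<in> grid d ?b \<Longrightarrow> \<bar>S (\<lambda>k. \<psi> d k y) \<omega>\<bar> \<le> U \<omega>"
      and E: "?E U \<le> 1 * (ln (2 * 2 ^ (?b * d)) + 3072 * real n * \<tau>\<^sup>2 + 1) / \<tau>"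
      unfolding S_def by blast
    have "real (?b * d) + 1 \<le> real d * (2 * real (?b + 0) + 2)"
    proof -
      have "?b * d + 1 \<le> d * (2 * (?b + 0) + 2)"
        using d by (simp add: distrib_left)
      then have "real (?b * d + 1) \<le> real (d * (2 * (?b + 0) + 2))"
        by (rule of_nat_mono)
      then show ?thesis
        by (simp only: of_nat_mult of_nat_add of_nat_1 of_nat_numeral)
    qed
    then have "real (?b * d) + 1 \<le> level_const * ?D * real (Suc 0)"
      using level_le[OF d, of 0] by (rule order_trans)
    then have "?E U \<le> 1 * (8 * (level_const + 49) * real (Suc 0)) * sqrt (real n * ?D)"
      by (intro order_trans[OF E level]) simp_all
    then have "?E U \<le> 8 * (level_const + 49) * sqrt (real n * ?D)"
      by (simp only: of_nat_Suc of_nat_0 add_0_right mult_1 mult_1_right)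
    with U show thesis
      by (rule that)
  qed
  have "\<exists>U. (\<forall>\<omega> x. x \<in> cube d \<longrightarrow>
         \<bar>S (\<lambda>k. \<psi> d k (dyadic_floor d (Suc (?b + j)) x) - \<psi> d k (dyadic_floor d (?b + j) x)) \<omega>\<bar> \<le> U \<omega>)
       \<and> ?E U \<le> scale * ratio ^ j * (8 * (level_const + 49) * real (Suc j)) * sqrt (real n * ?D)" for j
  proof -
    let ?l = "?b + j"
    \<comment> \<open>All neighbouring pairs from consecutive grids. Their number is bounded crudely
      by that of all pairs, since only its logarithm matters.\<close>
    define T where "T = {(y, y') \<in> grid d (Suc ?l) \<times> grid d ?l. \<forall>i<d. \<bar>y i - y' i\<bar> \<le> (1 / 2) ^ ?l}"
    have finT: "finite T"
      unfolding T_def by (rule finite_subset[of _ "grid d (Suc ?l) \<times> grid d ?l"]) auto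
    have "card T \<le> card (grid d (Suc ?l) \<times> grid d ?l)"
      unfolding T_def by (rule card_mono) auto
    then have "real (card T) \<le> real (card (grid d (Suc ?l))) * real (card (grid d ?l))"
      by (simp add: card_cartesian_product flip: of_nat_mult)
    also have "\<dots> \<le> 2 ^ (Suc ?l * d) * 2 ^ (?l * d)"
      by (intro mult_mono card_grid_le) auto
    also have "\<dots> = 2 ^ (Suc ?l * d + ?l * d)"
      by (simp only: power_add)
    finally have cardT: "real (card T) \<le> 2 ^ (Suc ?l * d + ?l * d)" .
    have hT: "(\<Sum>k\<in>A. ((\<lambda>(y, y') k. \<psi> d k y - \<psi> d k y') t k)\<^sup>2) \<le> (scale * ratio ^ j)\<^sup>2" if "t \<in> T" for t
    proof -
      obtain y y' where t: "t = (y, y')" by (cases t)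
      have dist: "\<And>i. i < d \<Longrightarrow> \<bar>y i - y' i\<bar> \<le> (1 / 2) ^ ?l"
        using that by (auto simp: T_def t)
      have "(\<Sum>k\<in>A. (\<psi> d k y - \<psi> d k y')\<^sup>2) \<le> (\<Sum>\<^sub>\<infinity>k\<in>Zd d. (\<psi> d k y - \<psi> d k y')\<^sup>2)"
        by (rule finite_sum_le_infsum[OF psi_diff_square(1)[OF dist] A]) auto
      also have "\<dots> \<le> 2 * hoelder_const * (real d * ((1 / 2) ^ ?l) powr s)"
        by (rule psi_diff_square(2)[OF dist]) simp_all
      finally have le: "(\<Sum>k\<in>A. (\<psi> d k y - \<psi> d k y')\<^sup>2) \<le> 2 * hoelder_const * (real d * ((1 / 2) ^ ?l) powr s)" .
      have "2 * hoelder_const * (real d * ((1 / 2) ^ ?l) powr s) \<le> 2 * hoelder_const * (ratio ^ j)\<^sup>2"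
        using hoelder_const_nonneg level_decay[OF d] by (intro mult_left_mono) auto
      also have "\<dots> \<le> (2 * hoelder_const + 1) * (ratio ^ j)\<^sup>2"
        by (intro mult_right_mono) auto
      also have "\<dots> = (scale * ratio ^ j)\<^sup>2"
        using hoelder_const_nonneg by (simp add: scale_def power_mult_distrib)
      finally show ?thesis using le by (simp add: t)
    qed
    have pos: "0 < scale * ratio ^ j" using scale_bounds ratio_bounds by simp
    have "\<exists>U. (\<forall>\<omega>. \<forall>t\<in>T. \<bar>\<Sum>i<n. centred_product A c ((\<lambda>(y, y') k. \<psi> d k y - \<psi> d k y') t) (\<omega> i)\<bar> \<le> U \<omega>) \<and>
        ?E U \<le> scale * ratio ^ j * (ln (2 * 2 ^ (Suc ?l * d + ?l * d)) + 3072 * real n * \<tau>\<^sup>2 + 1) / \<tau>"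
      by (intro sup_centred_product_bound A(1) c finT cardT hT pos \<tau>) simp_all
    then obtain U where U: "\<And>\<omega> t. t \<in> T \<Longrightarrow> \<bar>S ((\<lambda>(y, y') k. \<psi> d k y - \<psi> d k y') t) \<omega>\<bar> \<le> U \<omega>"
      and E: "?E U \<le> scale * ratio ^ j * (ln (2 * 2 ^ (Suc ?l * d + ?l * d)) + 3072 * real n * \<tau>\<^sup>2 + 1) / \<tau>"
      unfolding S_def by blast
    have "\<bar>S (\<lambda>k. \<psi> d k (dyadic_floor d (Suc ?l) x) - \<psi> d k (dyadic_floor d ?l x)) \<omega>\<bar> \<le> U \<omega>"
      if "x \<in> cube d" for x \<omega>
      using U[of "(dyadic_floor d (Suc ?l) x, dyadic_floor d ?l x)" \<omega>] that
      by (simp add: T_def dyadic_floor_in_grid dyadic_floor_diff_le)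
    moreover have "?E U \<le> scale * ratio ^ j * (8 * (level_const + 49) * real (Suc j)) * sqrt (real n * ?D)"
    proof (rule order_trans[OF E level[OF _ _ pos]])
      have "real (Suc ?l * d + ?l * d) + 1 \<le> real d * (2 * real ?l + 2)"
        using d by (simp add: algebra_simps)
      then show "real (Suc ?l * d + ?l * d) + 1 \<le> level_const * ?D * real (Suc j)"
        using level_le[OF d, of j] by (rule order_trans)
    qed simp
    ultimately show ?thesis by blast
  qed
  then have "\<exists>V. \<forall>j. (\<forall>\<omega> x. x \<in> cube d \<longrightarrow>
         \<bar>S (\<lambda>k. \<psi> d k (dyadic_floor d (Suc (?b + j)) x) - \<psi> d k (dyadic_floor d (?b + j) x)) \<omega>\<bar> \<le> V j \<omega>)
       \<and> ?E (V j) \<le> scale * ratio ^ j * (8 * (level_const + 49) * real (Suc j)) * sqrt (real n * ?D)"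
    by (intro choice allI)
  then obtain V where V: "\<And>j \<omega> x. x \<in> cube d \<Longrightarrow>
         \<bar>S (\<lambda>k. \<psi> d k (dyadic_floor d (Suc (?b + j)) x) - \<psi> d k (dyadic_floor d (?b + j) x)) \<omega>\<bar> \<le> V j \<omega>"
       and EV: "\<And>j. ?E (V j) \<le> scale * ratio ^ j * (8 * (level_const + 49) * real (Suc j)) * sqrt (real n * ?D)"
    by blast
  \<comment> \<open>The telescoping sum from the base grid up to level \<open>J\<close>.\<close>
  define W where "W \<omega> = U0 \<omega> + (\<Sum>j<J. V j \<omega>)" for \<omega>
  have W: "\<bar>S (\<lambda>k. \<psi> d k (dyadic_floor d (?b + J) x)) \<omega>\<bar> \<le> W \<omega>" if x: "x \<in> cube d" for \<omega> x
    unfolding W_def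
  proof (induction J)
    case 0
    then show ?case using U0 dyadic_floor_in_grid[OF x] by simp
  next
    case (Suc J)
    have "S (\<lambda>k. \<psi> d k (dyadic_floor d (?b + Suc J) x)) \<omega> = S (\<lambda>k. \<psi> d k (dyadic_floor d (?b + J) x)) \<omega>
        + S (\<lambda>k. \<psi> d k (dyadic_floor d (Suc (?b + J)) x) - \<psi> d k (dyadic_floor d (?b + J) x)) \<omega>"
      by (simp add: S_def centred_product_diff sum_subtractf)
    then show ?case using Suc.IH V[OF x, of J \<omega>] by simp
  qed
  have "?E W \<le> chain_const * sqrt (real n * ?D)"
  proof -
    define Q where "Q = 8 * (level_const + 49) * sqrt (real n * ?D)"
    have Q: "0 \<le> Q"
      unfolding Q_def using D s_bounds by (intro mult_nonneg_nonneg) (auto simp: level_const_def)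
    have EV_le: "?E (V j) \<le> Q * (scale * (real (Suc j) * ratio ^ j))" for j
    proof -
      have "scale * ratio ^ j * (8 * (level_const + 49) * real (Suc j)) * sqrt (real n * ?D)
          = Q * (scale * (real (Suc j) * ratio ^ j))"
        by (simp only: Q_def mult_ac)
      with EV[of j] show ?thesis by metis
    qed
    have "(\<lambda>j. real (Suc j) * ratio ^ j) sums (1 / (1 - ratio)\<^sup>2)"
      using geometric_deriv_sums[of ratio] ratio_bounds by simp
    \<comment> \<open>Partial sums stay below the full series, so the bound does not depend on
      \<open>J\<close> and the final grid may be arbitrarily fine.\<close>
    then have series: "(\<Sum>j<J. real (Suc j) * ratio ^ j) \<le> 1 / (1 - ratio)\<^sup>2"
      using ratio_bounds sum_le_suminf[of "\<lambda>j. real (Suc j) * ratio ^ j" "{..<J}"] by (auto simp: sums_iff)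
    have "?E W = ?E U0 + (\<Sum>j<J. ?E (V j))"
      unfolding W_def by (simp add: Bochner_Integration.integral_add[OF int int] Bochner_Integration.integral_sum[OF int])
    also have "\<dots> \<le> Q + (\<Sum>j<J. Q * (scale * (real (Suc j) * ratio ^ j)))"
      unfolding Q_def by (intro add_mono sum_mono EU0 EV_le[unfolded Q_def])
    also have "\<dots> = Q * (1 + scale * (\<Sum>j<J. real (Suc j) * ratio ^ j))"
      by (simp only: distrib_left mult_1_right sum_distrib_left)
    also have "\<dots> \<le> Q * (1 + scale * (1 / (1 - ratio)\<^sup>2))"
      using scale_bounds Q series by (intro mult_left_mono add_left_mono) auto
    also have "\<dots> = chain_const * sqrt (real n * ?D)"
      by (simp add: chain_const_def Q_def)
    finally show ?thesis .
  qed
  with W show ?thesis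
    unfolding S_def by (intro exI[of _ W] conjI allI ballI)
qed

end

subsection \<open>Functions in the Korobov space\<close>

text \<open>Finite subsets are handled by \<open>L2_set_mult_ineq\<close>, and the bound passes to
  the unordered sum.\<close>

lemma infsum_cauchy_schwarz:
  fixes f g :: "'a \<Rightarrow> real"
  assumes f: "(\<lambda>k. (f k)\<^sup>2) summable_on A" and g: "(\<lambda>k. (g k)\<^sup>2) summable_on A"
  shows "(\<lambda>k. f k * g k) summable_on A"
    and "\<bar>\<Sum>\<^sub>\<infinity>k\<in>A. f k * g k\<bar> \<le> sqrt (\<Sum>\<^sub>\<infinity>k\<in>A. (f k)\<^sup>2) * sqrt (\<Sum>\<^sub>\<infinity>k\<in>A. (g k)\<^sup>2)"
proof -
  have abs: "(\<lambda>k. norm (f k * g k)) summable_on A"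
    by (rule Infinite_Sum.abs_summable_product) (use f g in \<open>auto simp: power2_eq_square abs_mult\<close>)
  then show "(\<lambda>k. f k * g k) summable_on A"
    by (rule abs_summable_summable)
  have "\<bar>\<Sum>\<^sub>\<infinity>k\<in>A. f k * g k\<bar> \<le> (\<Sum>\<^sub>\<infinity>k\<in>A. norm (f k * g k))"
    using norm_infsum_bound[OF abs] by simp
  also have "\<dots> \<le> sqrt (\<Sum>\<^sub>\<infinity>k\<in>A. (f k)\<^sup>2) * sqrt (\<Sum>\<^sub>\<infinity>k\<in>A. (g k)\<^sup>2)"
  proof (rule infsum_le_finite_sums[OF abs])
    fix F assume F: "finite F" "F \<subseteq> A"
    have "(\<Sum>k\<in>F. norm (f k * g k)) = (\<Sum>k\<in>F. \<bar>f k\<bar> * \<bar>g k\<bar>)"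
      by (simp add: abs_mult)
    also have "\<dots> \<le> L2_set f F * L2_set g F"
      by (rule L2_set_mult_ineq)
    also have "\<dots> \<le> sqrt (\<Sum>\<^sub>\<infinity>k\<in>A. (f k)\<^sup>2) * sqrt (\<Sum>\<^sub>\<infinity>k\<in>A. (g k)\<^sup>2)"
      unfolding L2_set_def
      by (intro mult_mono real_sqrt_le_mono finite_sum_le_infsum f g F) (auto intro!: infsum_nonneg sum_nonneg)
    finally show "(\<Sum>k\<in>F. norm (f k * g k)) \<le> sqrt (\<Sum>\<^sub>\<infinity>k\<in>A. (f k)\<^sup>2) * sqrt (\<Sum>\<^sub>\<infinity>k\<in>A. (g k)\<^sup>2)" .
  qed
  finally show "\<bar>\<Sum>\<^sub>\<infinity>k\<in>A. f k * g k\<bar> \<le> sqrt (\<Sum>\<^sub>\<infinity>k\<in>A. (f k)\<^sup>2) * sqrt (\<Sum>\<^sub>\<infinity>k\<in>A. (g k)\<^sup>2)" .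
qed

section \<open>Measurability and uniform distance on the torus\<close>

lemma space_torus_subset_cube: "space (torus_measure d) \<subseteq> cube d"
  by (auto simp: torus_measure_def space_PiM cube_def PiE_def Pi_def space_restrict_space)

text \<open>Rounding is measurable into the finite grid with its discrete sigma-algebra, from which
  every \<open>g\<close> is measurable.\<close>

lemma measurable_dyadic_step:
  fixes g :: "(nat \<Rightarrow> real) \<Rightarrow> real"
  shows "(\<lambda>x. g (dyadic_floor d l x)) \<in> borel_measurable (torus_measure d)"
proof -
  let ?M = "torus_measure d"
  have comp: "(\<lambda>x. dyadic_floor d l x j) \<in> borel_measurable ?M" for j
  proof (cases "j < d")
    case True
    then have "(\<lambda>x. x j) \<in> measurable ?M (restrict_space lborel {0..<1::real})"
      unfolding torus_measure_def by (intro measurable_component_singleton) auto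
    then have "(\<lambda>x. x j) \<in> borel_measurable ?M"
      by (simp add: measurable_restrict_space2_iff)
    moreover have "(\<lambda>t :: real. real_of_int \<lfloor>2 ^ l * t\<rfloor> / 2 ^ l) \<in> borel_measurable borel"
      by measurable
    ultimately have "(\<lambda>x. real_of_int \<lfloor>2 ^ l * x j\<rfloor> / 2 ^ l) \<in> borel_measurable ?M"
      by (rule measurable_compose)
    then show ?thesis using True by (simp add: dyadic_floor_def)
  qed (simp add: dyadic_floor_def)
  have "dyadic_floor d l -` {y} \<inter> space ?M \<in> sets ?M" if "y \<in> grid d l" for y
  proof -
    have "dyadic_floor d l x = y \<longleftrightarrow> (\<forall>j\<in>{..<d}. dyadic_floor d l x j = y j)" for x
      using that by (auto simp: grid_def dyadic_floor_def fun_eq_iff)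
    then have "dyadic_floor d l -` {y} \<inter> space ?M = {x \<in> space ?M. \<forall>j\<in>{..<d}. dyadic_floor d l x j = y j}"
      by auto
    also have "\<dots> \<in> sets ?M"
      using comp by measurable
    finally show ?thesis .
  qed
  then have "dyadic_floor d l \<in> measurable ?M (count_space (grid d l))"
    unfolding measurable_count_space_eq2[OF finite_grid]
    using dyadic_floor_in_grid space_torus_subset_cube by blast
  then show ?thesis
    by (rule measurable_compose) simp
qed

lemma linf_dist_le:
  assumes "f \<in> borel_measurable (torus_measure d)" "g \<in> borel_measurable (torus_measure d)"
    and "\<And>x. x \<in> cube d \<Longrightarrow> \<bar>f x - g x\<bar> \<le> b"
  shows "linf_dist d f g \<le> ereal b"
  unfolding linf_dist_def
proof (rule esssup_I)
  show "(\<lambda>x. ereal \<bar>f x - g x\<bar>) \<in> borel_measurable (torus_measure d)"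
    using assms(1,2) by measurable
  show "AE x in torus_measure d. ereal \<bar>f x - g x\<bar> \<le> ereal b"
    using assms(3) space_torus_subset_cube by (intro AE_I2) auto
qed

context korobov
begin

abbreviation kfun :: "nat \<Rightarrow> ((nat \<Rightarrow> int) \<Rightarrow> real) \<Rightarrow> (nat \<Rightarrow> real) \<Rightarrow> real" where
  "kfun \<equiv> kor_fun \<beta>0 \<beta>1 r"

lemma kor_spaceD: "c \<in> kor_space d \<Longrightarrow> (\<lambda>k. (c k)\<^sup>2) summable_on Zd d"
  by (simp add: kor_space_def)

lemma psi_square_summable: "(\<lambda>k. (\<psi> d k x)\<^sup>2) summable_on Zd d"
  by (rule has_sum_imp_summable[OF psi_square_has_sum])

lemma kor_fun_summable: "c \<in> kor_space d \<Longrightarrow> (\<lambda>k. c k * \<psi> d k x) summable_on Zd d"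
  by (rule infsum_cauchy_schwarz(1)[OF kor_spaceD psi_square_summable])

lemma abs_kor_fun_le: "c \<in> kor_space d \<Longrightarrow> \<bar>kfun d c x\<bar> \<le> kor_norm d c"
  using infsum_cauchy_schwarz(2)[OF kor_spaceD psi_square_summable, of c d x]
  by (simp add: kor_fun_def kor_norm_def infsumI[OF psi_square_has_sum])

text \<open>Cauchy-Schwarz against the difference of the two vectors of basis values, whose norm
  \<open>psi_diff_square\<close> and \<open>level_decay\<close> control. It allows evaluation at
  grid points only.\<close>

lemma kor_fun_dyadic_diff:
  assumes "d \<ge> 1" and c: "c \<in> kor_space d"
  shows "\<bar>kfun d c x - kfun d c (dyadic_floor d (base_level d + j) x)\<bar> \<le> kor_norm d c * (sqrt (2 * hoelder_const) * ratio ^ j)"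
proof -
  let ?y = "dyadic_floor d (base_level d + j) x"
  have dist: "\<And>i. i < d \<Longrightarrow> \<bar>x i - ?y i\<bar> \<le> (1 / 2) ^ (base_level d + j)"
    by (rule dyadic_floor_diff_le)
  have sq: "(\<lambda>k. (\<psi> d k x - \<psi> d k ?y)\<^sup>2) summable_on Zd d"
    by (rule psi_diff_square(1)[OF dist]) simp_all
  have "kfun d c x = (\<Sum>\<^sub>\<infinity>k\<in>Zd d. c k * (\<psi> d k x - \<psi> d k ?y) + c k * \<psi> d k ?y)"
    unfolding kor_fun_def by (rule infsum_cong) (simp add: right_diff_distrib)
  also have "\<dots> = (\<Sum>\<^sub>\<infinity>k\<in>Zd d. c k * (\<psi> d k x - \<psi> d k ?y)) + kfun d c ?y"
    unfolding kor_fun_def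
    by (rule infsum_add[OF infsum_cauchy_schwarz(1)[OF kor_spaceD[OF c] sq] kor_fun_summable[OF c]])
  finally have "\<bar>kfun d c x - kfun d c ?y\<bar> = \<bar>\<Sum>\<^sub>\<infinity>k\<in>Zd d. c k * (\<psi> d k x - \<psi> d k ?y)\<bar>"
    by simp
  also have "\<dots> \<le> kor_norm d c * sqrt (\<Sum>\<^sub>\<infinity>k\<in>Zd d. (\<psi> d k x - \<psi> d k ?y)\<^sup>2)"
    unfolding kor_norm_def
    by (rule infsum_cauchy_schwarz(2)[OF kor_spaceD[OF c] sq])
  also have "\<dots> \<le> kor_norm d c * (sqrt (2 * hoelder_const) * ratio ^ j)"
  proof (rule mult_left_mono)
    have "(\<Sum>\<^sub>\<infinity>k\<in>Zd d. (\<psi> d k x - \<psi> d k ?y)\<^sup>2) \<le> 2 * hoelder_const * (real d * ((1 / 2) ^ (base_level d + j)) powr s)"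
      by (rule psi_diff_square(2)[OF dist]) simp_all
    also have "\<dots> \<le> 2 * hoelder_const * (ratio ^ j)\<^sup>2"
      using hoelder_const_nonneg level_decay[OF assms(1)] by (intro mult_left_mono) auto
    finally have "sqrt (\<Sum>\<^sub>\<infinity>k\<in>Zd d. (\<psi> d k x - \<psi> d k ?y)\<^sup>2) \<le> sqrt (2 * hoelder_const * (ratio ^ j)\<^sup>2)"
      by (rule real_sqrt_le_mono)
    also have "\<dots> = sqrt (2 * hoelder_const) * ratio ^ j"
      using ratio_bounds by (simp add: real_sqrt_mult)
    finally show "sqrt (\<Sum>\<^sub>\<infinity>k\<in>Zd d. (\<psi> d k x - \<psi> d k ?y)\<^sup>2) \<le> sqrt (2 * hoelder_const) * ratio ^ j" .
  qed (simp add: kor_norm_def infsum_nonneg)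
  finally show ?thesis .
qed

text \<open>Cauchy-Schwarz on the complement of \<open>A\<close>. The second factor is free of
  \<open>c\<close>, so one \<open>A\<close> serves the whole unit ball.\<close>

lemma kor_fun_truncation:
  assumes c: "c \<in> kor_space d" and A: "finite A" "A \<subseteq> Zd d"
  shows "\<bar>kfun d c y - (\<Sum>k\<in>A. c k * \<psi> d k y)\<bar> \<le> kor_norm d c * sqrt (1 - (\<Sum>k\<in>A. (\<psi> d k y)\<^sup>2))"
proof -
  have sub: "Zd d - A \<subseteq> Zd d" by blast
  have sm: "f summable_on Zd d \<Longrightarrow> f summable_on (Zd d - A)" for f :: "_ \<Rightarrow> real"
    using summable_on_subset_banach[OF _ sub] .
  have split: "infsum f (Zd d - A) = infsum f (Zd d) - sum f A" if "f summable_on Zd d" for f :: "_ \<Rightarrow> real"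
    using infsum_Diff[OF that _ A(2)] A(1) by simp
  have "kfun d c y - (\<Sum>k\<in>A. c k * \<psi> d k y) = (\<Sum>\<^sub>\<infinity>k\<in>Zd d - A. c k * \<psi> d k y)"
    by (simp add: split kor_fun_summable[OF c] kor_fun_def)
  also have "\<bar>\<dots>\<bar> \<le> sqrt (\<Sum>\<^sub>\<infinity>k\<in>Zd d - A. (c k)\<^sup>2) * sqrt (\<Sum>\<^sub>\<infinity>k\<in>Zd d - A. (\<psi> d k y)\<^sup>2)"
    by (rule infsum_cauchy_schwarz(2)[OF sm[OF kor_spaceD[OF c]] sm[OF psi_square_summable]])
  also have "(\<Sum>\<^sub>\<infinity>k\<in>Zd d - A. (\<psi> d k y)\<^sup>2) = 1 - (\<Sum>k\<in>A. (\<psi> d k y)\<^sup>2)"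
    by (simp add: split psi_square_summable infsumI[OF psi_square_has_sum])
  also have "sqrt (\<Sum>\<^sub>\<infinity>k\<in>Zd d - A. (c k)\<^sup>2) * sqrt (1 - (\<Sum>k\<in>A. (\<psi> d k y)\<^sup>2)) \<le> kor_norm d c * sqrt (1 - (\<Sum>k\<in>A. (\<psi> d k y)\<^sup>2))"
  proof (rule mult_right_mono)
    have "(\<Sum>\<^sub>\<infinity>k\<in>Zd d - A. (c k)\<^sup>2) \<le> (\<Sum>\<^sub>\<infinity>k\<in>Zd d. (c k)\<^sup>2)"
      by (simp add: split kor_spaceD[OF c] sum_nonneg)
    then show "sqrt (\<Sum>\<^sub>\<infinity>k\<in>Zd d - A. (c k)\<^sup>2) \<le> kor_norm d c"
      by (simp add: kor_norm_def)
    show "0 \<le> sqrt (1 - (\<Sum>k\<in>A. (\<psi> d k y)\<^sup>2))"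
      using finite_sum_le_has_sum[OF psi_square_has_sum A, of y] by simp
  qed
  finally show ?thesis .
qed

text \<open>By \<open>kor_fun_dyadic_diff\<close> the function is the limit of its dyadic step
  functions.\<close>

lemma kor_fun_measurable:
  assumes d: "d \<ge> 1" and c: "c \<in> kor_space d"
  shows "kfun d c \<in> borel_measurable (torus_measure d)"
proof (rule borel_measurable_LIMSEQ_real)
  show "(\<lambda>x. kfun d c (dyadic_floor d (base_level d + j) x)) \<in> borel_measurable (torus_measure d)" for j
    by (rule measurable_dyadic_step)
  fix x
  let ?b = "\<lambda>j. kor_norm d c * (sqrt (2 * hoelder_const) * ratio ^ j)"
  have "(\<lambda>j. ratio ^ j) \<longlonglongrightarrow> 0"
    using ratio_bounds by (intro LIMSEQ_power_zero) auto
  then have lim: "?b \<longlonglongrightarrow> 0"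
    by (intro tendsto_mult_right_zero)
  have "\<forall>j. norm (kfun d c (dyadic_floor d (base_level d + j) x) - kfun d c x) \<le> ?b j"
    using kor_fun_dyadic_diff[OF d c, of x] by (simp only: real_norm_def abs_minus_commute) simp
  then have "(\<lambda>j. kfun d c (dyadic_floor d (base_level d + j) x) - kfun d c x) \<longlonglongrightarrow> 0"
    by (rule Lim_null_comparison[OF always_eventually lim])
  then show "(\<lambda>j. kfun d c (dyadic_floor d (base_level d + j) x)) \<longlonglongrightarrow> kfun d c x"
    by (rule LIM_zero_cancel)
qed

end

subsection \<open>The randomized method\<close>

lemma e2ennreal_ereal_le: "x \<le> ereal b \<Longrightarrow> e2ennreal x \<le> ennreal b"
  using e2ennreal_mono[of x "ereal b"] by simp

text \<open>\<open>n_ran\<close> takes its sample points from \<open>nat \<Rightarrow> real\<close>;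
  this embeds the finitely many sign matrices there.\<close>

lemma finite_encoding:
  fixes M :: "'a set"
  assumes "finite M"
  obtains enc :: "'a \<Rightarrow> nat \<Rightarrow> real" where "inj_on enc M"
proof -
  from finite_imp_inj_to_nat_seg[OF assms] obtain f :: "'a \<Rightarrow> nat" where "inj_on f M"
    by blast
  then have "inj_on (\<lambda>m (_ :: nat). real (f m)) M"
    by (auto simp: inj_on_def fun_eq_iff)
  then show thesis by (rule that)
qed

context korobov
begin

text \<open>The zero output already has error at most 1. For large \<open>\<epsilon>\<close> the
  claimed bound drops below 1, so exactly 0 functionals are required.\<close>

lemma n_ran_eq_0:
  assumes d: "d \<ge> 1" and \<epsilon>: "1 \<le> \<epsilon>"
  shows "n_ran \<beta>0 \<beta>1 r d \<epsilon> = 0"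
proof -
  let ?P = "measure_pmf (return_pmf (\<lambda>_. 0)) :: (nat \<Rightarrow> real) measure"
  let ?L = "\<lambda>(\<omega> :: nat \<Rightarrow> real) (i :: nat) (c :: (nat \<Rightarrow> int) \<Rightarrow> real). 0 :: real"
  let ?\<phi> = "\<lambda>(\<omega> :: nat \<Rightarrow> real) (y :: nat \<Rightarrow> real) (x :: nat \<Rightarrow> real). 0 :: real"
  have "ran_method \<beta>0 \<beta>1 r d 0 ?P ?L ?\<phi>"
    unfolding ran_method_def
  proof (intro conjI ballI allI impI)
    show "prob_space ?P" by (rule prob_space_measure_pmf)
    have "esssup (torus_measure d) (\<lambda>x. ereal \<bar>0\<bar>) \<le> ereal 0"
      by (rule esssup_I) auto
    then show "esssup (torus_measure d) (\<lambda>x. ereal \<bar>0\<bar>) < \<infinity>"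
      by (rule le_less_trans) simp
  qed auto
  moreover have "ran_error \<beta>0 \<beta>1 r d 0 ?P ?L ?\<phi> \<le> ennreal \<epsilon>"
    unfolding ran_error_def
  proof (intro SUP_least)
    fix c assume "c \<in> {c \<in> kor_space d. kor_norm d c \<le> 1}"
    then have c: "c \<in> kor_space d" "kor_norm d c \<le> 1" by auto
    have "linf_dist d (kfun d c) (\<lambda>x. 0) \<le> ereal \<epsilon>"
    proof (rule linf_dist_le[OF kor_fun_measurable[OF d c(1)]])
      show "\<bar>kfun d c x - 0\<bar> \<le> \<epsilon>" for x
        using abs_kor_fun_le[OF c(1), of x] c(2) \<epsilon> by simp
    qed simp
    then have "e2ennreal (linf_dist d (kfun d c) (\<lambda>x. 0)) \<le> ennreal \<epsilon>"
      by (rule e2ennreal_ereal_le)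
    then show "(\<integral>\<^sup>+ \<omega>. e2ennreal (linf_dist d (kfun d c) (ran_output 0 ?L ?\<phi> \<omega> c)) \<partial>?P) \<le> ennreal \<epsilon>"
      by (simp add: ran_output_def)
  qed
  ultimately have "n_ran \<beta>0 \<beta>1 r d \<epsilon> \<le> 0"
    unfolding n_ran_def by (intro Least_le) blast
  then show ?thesis by simp
qed

lemma dyadic_level_exists:
  assumes "0 < \<delta>"
  obtains j where "sqrt (2 * hoelder_const) * ratio ^ j \<le> \<delta>"
proof -
  define q where "q = sqrt (2 * hoelder_const) + 1"
  have q: "0 < q" using hoelder_const_nonneg by (simp add: q_def add_nonneg_pos)
  then obtain j where "ratio ^ j < \<delta> / q"
    using real_arch_pow_inv[of "\<delta> / q" ratio] ratio_bounds assms by auto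
  then have "(sqrt (2 * hoelder_const) + 1) * ratio ^ j \<le> \<delta>"
    unfolding q_def[symmetric] using q by (simp add: field_simps)
  moreover have "sqrt (2 * hoelder_const) * ratio ^ j \<le> (sqrt (2 * hoelder_const) + 1) * ratio ^ j"
    using ratio_bounds by (intro mult_right_mono) auto
  ultimately show thesis
    using that[of j] by linarith
qed

text \<open>At each point the squared basis values sum to 1, so a finite set captures all but
  \<open>\<delta>^2\<close> of the mass. The union over the finite \<open>G\<close> only lowers the
  tails.\<close>

lemma frequency_set_exists:
  assumes G: "finite G" and "0 < \<delta>"
  obtains A where "finite A" "A \<subseteq> Zd d" "\<And>y. y \<in> G \<Longrightarrow> sqrt (1 - (\<Sum>k\<in>A. (\<psi> d k y)\<^sup>2)) \<le> \<delta>"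
proof -
  have "\<exists>F. finite F \<and> F \<subseteq> Zd d \<and> 1 - \<delta>\<^sup>2 \<le> (\<Sum>k\<in>F. (\<psi> d k y)\<^sup>2)" for y
  proof (rule ccontr)
    assume *: "\<not> ?thesis"
    have "(\<Sum>k\<in>F. (\<psi> d k y)\<^sup>2) \<le> 1 - \<delta>\<^sup>2" if "finite F" "F \<subseteq> Zd d" for F
    proof (rule ccontr)
      assume "\<not> ?thesis"
      then have "1 - \<delta>\<^sup>2 \<le> (\<Sum>k\<in>F. (\<psi> d k y)\<^sup>2)" by linarith
      with * that show False by blast
    qed
    then have "1 \<le> 1 - \<delta>\<^sup>2"
      by (rule has_sum_le_finite_sums[OF psi_square_has_sum])
    then show False using \<open>0 < \<delta>\<close> by simp
  qed
  then have "\<exists>F. \<forall>y. finite (F y) \<and> F y \<subseteq> Zd d \<and> 1 - \<delta>\<^sup>2 \<le> (\<Sum>k\<in>F y. (\<psi> d k y)\<^sup>2)"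
    by (intro choice allI)
  then obtain F where F: "\<And>y. finite (F y)" "\<And>y. F y \<subseteq> Zd d" "\<And>y. 1 - \<delta>\<^sup>2 \<le> (\<Sum>k\<in>F y. (\<psi> d k y)\<^sup>2)"
    by blast
  show thesis
  proof (rule that[of "\<Union>y\<in>G. F y"])
    fix y assume "y \<in> G"
    then have "(\<Sum>k\<in>F y. (\<psi> d k y)\<^sup>2) \<le> (\<Sum>k\<in>(\<Union>y\<in>G. F y). (\<psi> d k y)\<^sup>2)"
      using G F(1) by (intro sum_mono2) auto
    with F(3)[of y] have "1 - (\<Sum>k\<in>(\<Union>y\<in>G. F y). (\<psi> d k y)\<^sup>2) \<le> \<delta>\<^sup>2"
      by linarith
    from real_sqrt_le_mono[OF this] show "sqrt (1 - (\<Sum>k\<in>(\<Union>y\<in>G. F y). (\<psi> d k y)\<^sup>2)) \<le> \<delta>"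
      using \<open>0 < \<delta>\<close> by simp
  qed (use G F in auto)
qed

lemma cont_lin_functional_finite_sum:
  assumes A: "finite A" "A \<subseteq> Zd d"
  shows "cont_lin_functional d (\<lambda>c. \<Sum>k\<in>A. b k * c k)"
  unfolding cont_lin_functional_def
proof (intro conjI ballI allI exI)
  fix c assume "c \<in> kor_space d"
  then have "(\<Sum>k\<in>A. (c k)\<^sup>2) \<le> (\<Sum>\<^sub>\<infinity>k\<in>Zd d. (c k)\<^sup>2)"
    by (intro finite_sum_le_infsum kor_spaceD A) auto
  then have "L2_set c A \<le> kor_norm d c"
    by (simp add: L2_set_def kor_norm_def)
  then have "L2_set b A * L2_set c A \<le> L2_set b A * kor_norm d c"
    by (rule mult_left_mono) (simp add: L2_set_nonneg)
  moreover have "\<bar>\<Sum>k\<in>A. b k * c k\<bar> \<le> (\<Sum>k\<in>A. \<bar>b k\<bar> * \<bar>c k\<bar>)"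
    by (rule order_trans[OF sum_abs]) (simp add: abs_mult)
  moreover have "\<dots> \<le> L2_set b A * L2_set c A"
    by (rule L2_set_mult_ineq)
  ultimately show "\<bar>\<Sum>k\<in>A. b k * c k\<bar> \<le> L2_set b A * kor_norm d c"
    by linarith
qed (simp_all add: distrib_left sum.distrib sum_distrib_left mult_ac)

text \<open>The error splits into \<open>\<epsilon> / 4\<close> for rounding the point,
  \<open>\<epsilon> / 4\<close> for truncation to \<open>A\<close>, and a random part of mean at
  most \<open>\<epsilon> / 2\<close>. The second condition on \<open>n\<close> is the squared form
  of the last requirement.\<close>

lemma n_ran_le:
  assumes d: "d \<ge> 1" and \<epsilon>: "0 < \<epsilon>" and n: "cost d \<le> real n" "4 * chain_const\<^sup>2 * cost d \<le> \<epsilon>\<^sup>2 * real n"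
  shows "n_ran \<beta>0 \<beta>1 r d \<epsilon> \<le> n"
proof -
  have D: "1 \<le> cost d" using cost_ge_1[OF d] .
  then have n0: "0 < real n" using n(1) by linarith
  have e4: "0 < \<epsilon> / 4" using \<epsilon> by simp
  obtain J where J: "sqrt (2 * hoelder_const) * ratio ^ J \<le> \<epsilon> / 4"
    using dyadic_level_exists[OF e4] by blast
  define fl where "fl = dyadic_floor d (base_level d + J)"
  obtain A where A: "finite A" "A \<subseteq> Zd d"
    and tail: "\<And>y. y \<in> grid d (base_level d + J) \<Longrightarrow> sqrt (1 - (\<Sum>k\<in>A. (\<psi> d k y)\<^sup>2)) \<le> \<epsilon> / 4"
    using frequency_set_exists[OF finite_grid[of d "base_level d + J"] e4] by blast
  have finM: "finite (set_pmf (sign_matrix n A))"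
    using A by simp
  obtain enc :: "_ \<Rightarrow> nat \<Rightarrow> real" where enc: "inj_on enc (set_pmf (sign_matrix n A))"
    using finite_encoding[OF finM] by blast
  define dec where "dec = inv_into (set_pmf (sign_matrix n A)) enc"
  define P where "P = measure_pmf (map_pmf enc (sign_matrix n A))"
  define L where "L \<omega> i c = (\<Sum>k\<in>A. dec \<omega> i k * c k)" for \<omega> i and c :: "(nat \<Rightarrow> int) \<Rightarrow> real"
  \<comment> \<open>The average of the rank-one operators, read off at the rounded point. The output
    is thus a step function, measurable and bounded whatever the data \<open>y\<close>.\<close>
  define \<phi> where "\<phi> \<omega> y x = (\<Sum>i<n. y i * (\<Sum>k\<in>A. dec \<omega> i k * \<psi> d k (fl x))) / real n"
    for \<omega> and y x :: "nat \<Rightarrow> real"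
  have \<phi>_meas: "\<phi> \<omega> y \<in> borel_measurable (torus_measure d)" for \<omega> y
    unfolding \<phi>_def fl_def by (rule measurable_dyadic_step)
  have "ran_method \<beta>0 \<beta>1 r d n P L \<phi>"
    unfolding ran_method_def
  proof (intro conjI ballI allI impI)
    show "prob_space P" unfolding P_def by (rule prob_space_measure_pmf)
    show "cont_lin_functional d (L \<omega> i)" for \<omega> i
      unfolding L_def by (rule cont_lin_functional_finite_sum[OF A])
    show "\<phi> \<omega> y \<in> borel_measurable (torus_measure d)" for \<omega> y
      by (rule \<phi>_meas)
    show "esssup (torus_measure d) (\<lambda>x. ereal \<bar>\<phi> \<omega> y x\<bar>) < \<infinity>" for \<omega> y
    proof -
      let ?g = "\<lambda>z. \<bar>(\<Sum>i<n. y i * (\<Sum>k\<in>A. dec \<omega> i k * \<psi> d k z)) / real n\<bar>"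
      define b where "b = (\<Sum>z\<in>grid d (base_level d + J). ?g z)"
      have "esssup (torus_measure d) (\<lambda>x. ereal \<bar>\<phi> \<omega> y x\<bar>) \<le> ereal b"
      proof (rule esssup_I)
        show "(\<lambda>x. ereal \<bar>\<phi> \<omega> y x\<bar>) \<in> borel_measurable (torus_measure d)"
          using \<phi>_meas[of \<omega> y] by measurable
        show "AE x in torus_measure d. ereal \<bar>\<phi> \<omega> y x\<bar> \<le> ereal b"
        proof (rule AE_I2)
          fix x assume "x \<in> space (torus_measure d)"
          then have "fl x \<in> grid d (base_level d + J)"
            using space_torus_subset_cube unfolding fl_def by (intro dyadic_floor_in_grid) blast
          then have "?g (fl x) \<le> b"
            unfolding b_def by (intro member_le_sum) auto
          then show "ereal \<bar>\<phi> \<omega> y x\<bar> \<le> ereal b"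
            by (simp add: \<phi>_def)
        qed
      qed
      then show ?thesis by (rule le_less_trans) simp
    qed
    show "(\<lambda>\<omega>. linf_dist d (kfun d c) (ran_output n L \<phi> \<omega> c)) \<in> borel_measurable P" for c
      unfolding P_def by simp
  qed
  moreover have "ran_error \<beta>0 \<beta>1 r d n P L \<phi> \<le> ennreal \<epsilon>"
    unfolding ran_error_def
  proof (intro SUP_least)
    fix c assume "c \<in> {c \<in> kor_space d. kor_norm d c \<le> 1}"
    then have c: "c \<in> kor_space d" "kor_norm d c \<le> 1" by auto
    have "(\<Sum>k\<in>A. (c k)\<^sup>2) \<le> (\<Sum>\<^sub>\<infinity>k\<in>Zd d. (c k)\<^sup>2)"
      using c by (intro finite_sum_le_infsum kor_spaceD A) auto
    also have "\<dots> \<le> 1" using c(2) by (simp add: kor_norm_def)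
    finally have cA: "(\<Sum>k\<in>A. (c k)\<^sup>2) \<le> 1" .
    have "\<exists>U. (\<forall>\<omega>. \<forall>x\<in>cube d. \<bar>\<Sum>i<n. centred_product A c (\<lambda>k. \<psi> d k (fl x)) (\<omega> i)\<bar> \<le> U \<omega>) \<and>
        measure_pmf.expectation (sign_matrix n A) U \<le> chain_const * sqrt (real n * cost d)"
      unfolding fl_def by (rule chaining[OF A cA d n(1)])
    then obtain U where U: "\<And>\<omega> x. x \<in> cube d \<Longrightarrow>
        \<bar>\<Sum>i<n. centred_product A c (\<lambda>k. \<psi> d k (fl x)) (\<omega> i)\<bar> \<le> U \<omega>"
      and EU: "measure_pmf.expectation (sign_matrix n A) U \<le> chain_const * sqrt (real n * cost d)"
      by blast
    \<comment> \<open>The cube is nonempty, so \<open>U\<close> dominates some absolute value;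
      nonnegativity lets the integral be computed as an expectation.\<close>
    have U0: "0 \<le> U \<omega>" for \<omega>
      using U[of "\<lambda>_. 0" \<omega>] by (force simp: cube_def)
    have pointwise: "e2ennreal (linf_dist d (kfun d c) (ran_output n L \<phi> (enc \<omega>) c)) \<le> ennreal (\<epsilon> / 2 + U \<omega> / real n)"
      if \<omega>: "\<omega> \<in> set_pmf (sign_matrix n A)" for \<omega>
    proof (intro e2ennreal_ereal_le linf_dist_le kor_fun_measurable[OF d c(1)])
      show "ran_output n L \<phi> (enc \<omega>) c \<in> borel_measurable (torus_measure d)"
        unfolding ran_output_def by (rule \<phi>_meas)
      fix x assume x: "x \<in> cube d"
      let ?f = "\<Sum>k\<in>A. c k * \<psi> d k (fl x)"
      let ?S = "\<Sum>i<n. centred_product A c (\<lambda>k. \<psi> d k (fl x)) (\<omega> i)"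
      have "dec (enc \<omega>) = \<omega>"
        unfolding dec_def by (rule inv_into_f_f[OF enc \<omega>])
      then have "ran_output n L \<phi> (enc \<omega>) c x = (\<Sum>i<n. (\<Sum>k\<in>A. \<omega> i k * c k) * (\<Sum>k\<in>A. \<omega> i k * \<psi> d k (fl x))) / real n"
        by (simp add: ran_output_def \<phi>_def L_def)
      \<comment> \<open>Each product is its centred version plus its mean, and the mean is the
        truncated function value.\<close>
      also have "\<dots> = (?S + real n * ?f) / real n"
        by (simp add: centred_product_def sum_subtractf)
      also have "\<dots> = ?S / real n + ?f"
        using n0 by (simp add: add_divide_distrib)
      finally have out: "ran_output n L \<phi> (enc \<omega>) c x = ?S / real n + ?f" .
      have "\<bar>kfun d c x - kfun d c (fl x)\<bar> \<le> kor_norm d c * (sqrt (2 * hoelder_const) * ratio ^ J)"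
        unfolding fl_def by (rule kor_fun_dyadic_diff[OF d c(1)])
      also have "\<dots> \<le> 1 * (\<epsilon> / 4)"
        using J c(2) hoelder_const_nonneg ratio_bounds by (intro mult_mono) auto
      finally have 1: "\<bar>kfun d c x - kfun d c (fl x)\<bar> \<le> \<epsilon> / 4" by simp
      have "\<bar>kfun d c (fl x) - ?f\<bar> \<le> kor_norm d c * sqrt (1 - (\<Sum>k\<in>A. (\<psi> d k (fl x))\<^sup>2))"
        by (rule kor_fun_truncation[OF c(1) A])
      also have "\<dots> \<le> 1 * (\<epsilon> / 4)"
      proof (rule mult_mono)
        show "sqrt (1 - (\<Sum>k\<in>A. (\<psi> d k (fl x))\<^sup>2)) \<le> \<epsilon> / 4"
          unfolding fl_def by (rule tail[OF dyadic_floor_in_grid[OF x]])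
        show "0 \<le> sqrt (1 - (\<Sum>k\<in>A. (\<psi> d k (fl x))\<^sup>2))"
          using finite_sum_le_has_sum[OF psi_square_has_sum A, of "fl x"] by simp
      qed (use c(2) in auto)
      finally have 2: "\<bar>kfun d c (fl x) - ?f\<bar> \<le> \<epsilon> / 4" by simp
      have 3: "\<bar>?S / real n\<bar> \<le> U \<omega> / real n"
        using U[OF x, of \<omega>] n0 by (simp add: divide_right_mono)
      show "\<bar>kfun d c x - ran_output n L \<phi> (enc \<omega>) c x\<bar> \<le> \<epsilon> / 2 + U \<omega> / real n"
        unfolding out using 1 2 3 by linarith
    qed
    have int: "integrable (measure_pmf (sign_matrix n A)) f" for f :: "_ \<Rightarrow> real"
      using A by (intro integrable_measure_pmf_finite) simp
    have "(\<integral>\<^sup>+ \<omega>. e2ennreal (linf_dist d (kfun d c) (ran_output n L \<phi> \<omega> c)) \<partial>P)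
        = (\<integral>\<^sup>+ \<omega>. e2ennreal (linf_dist d (kfun d c) (ran_output n L \<phi> (enc \<omega>) c)) \<partial>measure_pmf (sign_matrix n A))"
      unfolding P_def by simp
    also have "\<dots> \<le> (\<integral>\<^sup>+ \<omega>. ennreal (\<epsilon> / 2 + U \<omega> / real n) \<partial>measure_pmf (sign_matrix n A))"
      by (intro nn_integral_mono_AE AE_pmfI pointwise)
    also have "\<dots> = ennreal (measure_pmf.expectation (sign_matrix n A) (\<lambda>\<omega>. \<epsilon> / 2 + U \<omega> / real n))"
      using U0 \<epsilon> n0 by (intro nn_integral_eq_integral int AE_pmfI) auto
    also have "\<dots> \<le> ennreal \<epsilon>"
    proof (rule ennreal_leI)
      have "measure_pmf.expectation (sign_matrix n A) (\<lambda>\<omega>. \<epsilon> / 2 + U \<omega> / real n)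
          = \<epsilon> / 2 + measure_pmf.expectation (sign_matrix n A) U / real n"
        by (simp add: Bochner_Integration.integral_add[OF int int])
      also have "\<dots> \<le> \<epsilon> / 2 + (\<epsilon> / 2 * real n) / real n"
      proof (intro add_left_mono divide_right_mono order_trans[OF EU])
        have "(2 * chain_const * sqrt (real n * cost d))\<^sup>2 = (4 * chain_const\<^sup>2 * cost d) * real n"
          using D n0 by (simp add: power_mult_distrib)
        also have "\<dots> \<le> (\<epsilon>\<^sup>2 * real n) * real n"
          by (rule mult_right_mono[OF n(2)]) simp
        also have "\<dots> = (\<epsilon> * real n)\<^sup>2"
          by (simp add: power2_eq_square)
        finally have "2 * chain_const * sqrt (real n * cost d) \<le> \<epsilon> * real n"
          by (rule power2_le_imp_le) (use \<epsilon> in simp)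
        then show "chain_const * sqrt (real n * cost d) \<le> \<epsilon> / 2 * real n"
          by simp
      qed simp
      also have "\<dots> = \<epsilon>" using n0 by simp
      finally show "measure_pmf.expectation (sign_matrix n A) (\<lambda>\<omega>. \<epsilon> / 2 + U \<omega> / real n) \<le> \<epsilon>" .
    qed
    finally show "(\<integral>\<^sup>+ \<omega>. e2ennreal (linf_dist d (kfun d c) (ran_output n L \<phi> \<omega> c)) \<partial>P) \<le> ennreal \<epsilon>" .
  qed
  ultimately show ?thesis
    unfolding n_ran_def by (intro Least_le) blast
qed

lemma n_ran_bound:
  assumes d: "d \<ge> 1" and \<epsilon>: "0 < \<epsilon>"
  shows "real (n_ran \<beta>0 \<beta>1 r d \<epsilon>) \<le> (4 * chain_const\<^sup>2 + 1) * (\<epsilon> powr (-2) * cost d)"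
proof (cases "1 \<le> \<epsilon>")
  case True
  then show ?thesis
    using n_ran_eq_0[OF d True] cost_ge_1[OF d] by simp
next
  case False
  define a where "a = \<epsilon> powr (-2) * cost d"
  \<comment> \<open>Rounding up costs at most 1, absorbed by \<open>a \<ge> 1\<close>; this is the
    \<open>+ 1\<close> in the final constant.\<close>
  define n where "n = nat \<lceil>4 * chain_const\<^sup>2 * a\<rceil>"
  have D: "1 \<le> cost d" using cost_ge_1[OF d] .
  have \<epsilon>2: "\<epsilon>\<^sup>2 * \<epsilon> powr (-2) = 1"
    using \<epsilon> by (simp add: powr_minus powr_numeral)
  have "\<epsilon>\<^sup>2 * \<epsilon> powr (-2) \<le> 1 * \<epsilon> powr (-2)"
    using False \<epsilon> by (intro mult_right_mono power_le_one) auto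
  then have "1 \<le> \<epsilon> powr (-2)" unfolding \<epsilon>2 by simp
  then have a: "cost d \<le> a" "1 \<le> a"
    unfolding a_def using D mult_mono[of 1 "\<epsilon> powr (-2)" "cost d" "cost d"] mult_mono[of 1 "\<epsilon> powr (-2)" 1 "cost d"] by simp_all
  have C: "1 \<le> chain_const\<^sup>2" using chain_const_ge_1 by simp
  have n: "4 * chain_const\<^sup>2 * a \<le> real n" "real n \<le> 4 * chain_const\<^sup>2 * a + 1"
    using a C by (auto simp: n_def)
  have "n_ran \<beta>0 \<beta>1 r d \<epsilon> \<le> n"
  proof (rule n_ran_le[OF d \<epsilon>])
    have "1 * a \<le> 4 * chain_const\<^sup>2 * a"
      using a C by (intro mult_right_mono) auto
    then show "cost d \<le> real n" using a n by linarith
    have "4 * chain_const\<^sup>2 * cost d = \<epsilon>\<^sup>2 * (4 * chain_const\<^sup>2 * a)"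
      using \<epsilon>2 by (simp add: a_def)
    also have "\<dots> \<le> \<epsilon>\<^sup>2 * real n"
      by (rule mult_left_mono[OF n(1)]) simp
    finally show "4 * chain_const\<^sup>2 * cost d \<le> \<epsilon>\<^sup>2 * real n" .
  qed
  then have "real (n_ran \<beta>0 \<beta>1 r d \<epsilon>) \<le> 4 * chain_const\<^sup>2 * a + 1"
    using n(2) by linarith
  also have "\<dots> \<le> (4 * chain_const\<^sup>2 + 1) * a"
    using a by (simp add: distrib_right)
  finally show ?thesis by (simp add: a_def)
qed

end

theorem theorem3p7:
  fixes r \<beta>0 \<beta>1 :: real
  assumes "r > 1/2" and "\<beta>0 > 0" and "\<beta>1 > 0"
    and "\<beta>0 + \<beta>1 * zeta_real (2 * r) = 1"
  shows "\<exists>C>0. \<forall>(d::nat) (\<epsilon>::real). d \<ge> 1 \<longrightarrow> \<epsilon> > 0 \<longrightarrow>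
           real (n_ran \<beta>0 \<beta>1 r d \<epsilon>) \<le> C * \<epsilon> powr (-2) * real d * (1 + ln (real d))"
proof -
  interpret korobov r \<beta>0 \<beta>1
    using assms by unfold_locales
  show ?thesis
  proof (intro exI conjI allI impI)
    show "0 < 4 * chain_const\<^sup>2 + 1"
      by (simp add: add_nonneg_pos)
    show "real (n_ran \<beta>0 \<beta>1 r d \<epsilon>) \<le> (4 * chain_const\<^sup>2 + 1) * \<epsilon> powr (-2) * real d * (1 + ln (real d))"
      if "d \<ge> 1" "\<epsilon> > 0" for d :: nat and \<epsilon> :: real
      using n_ran_bound[OF that] by (simp only: cost_def mult.assoc)
  qed
qed

end
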